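(* Let $K$ be an infinite field, $R=K[x,y,z]$, and $I=(x^a,y^b,z^c,x^\alpha y^\beta z^\gamma)$, where $0\le\alpha<a$, $0\le\beta<b$, $0\le\gamma<c$ are integers and at most one of $\alpha,\beta,\gamma$ is zero. Suppose $a+b+c+\alpha+\beta+\gamma\equiv 0\pmod 3$, put $s=\frac13(a+b+c+\alpha+\beta+\gamma)-2$, $A=s+2-a$, $B=s+2-b$, $C=s+2-c$, $M=s+2-(\alpha+\beta+\gamma)$, and assume $0\le M$, $0\le A\le\beta+\gamma$, $0\le B\le\alpha+\gamma$, $0\le C\le\alpha+\beta$. Then there exists a matrix $N=N_{a,b,c,\alpha,\beta,\gamma}$ such that: (i) $N$ is a square integer matrix of size $C+M$; (ii) $R/I$ has the weak Lefschetz property if and only if $\det N\not\equiv0\pmod{\operatorname{char}K}$; (iii) the entries of $N$ are given by $$(N)_{i,j}=\begin{cases}\binom{c}{A+j-i}&\text{if }1\le i\le C,\\[2pt] \binom{\gamma}{A+C-\beta+j-i}&\text{if }C+1\le i\le C+M.\end{cases}$$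
   Context: $R$ is standard graded. Binomial coefficients $\binom nk$ with $n\ge0$ are zero when $k<0$ or $k>n$; the determinant of the empty matrix is $1$. When $\operatorname{char}K=0$, "$\det N\not\equiv0\pmod{\operatorname{char} K}$" means $\det N\ne0$. An artinian standard graded $K$-algebra $Q$ has the weak Lefschetz property if there is a linear form $\ell\in[Q]_1$ such that for all integers $d$ the map $\times\ell:[Q]_d\to[Q]_{d+1}$ is injective or surjective. *)

theory Defs
  imports
    "HOL-Algebra.Algebraic_Closure_Type"
    "HOL-Algebra.QuotRing"
    "HOL-Library.Poly_Mapping"
    "HOL-Library.Product_Plus"
    "HOL-Number_Theory.Cong"
    "Jordan_Normal_Form.Determinant"
begin

text \<open>The polynomial ring in three variables over \<open>'k\<close>: finitely supported functions
  from exponent triples to coefficients, with the convolution product of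
  \<^theory>\<open>HOL-Library.Poly_Mapping\<close>.\<close>

type_synonym 'k poly3 = "(nat \<times> nat \<times> nat) \<Rightarrow>\<^sub>0 'k"

definition var_x :: "'k::comm_ring_1 poly3" where
  "var_x = Poly_Mapping.single (1, 0, 0) 1"

definition var_y :: "'k::comm_ring_1 poly3" where
  "var_y = Poly_Mapping.single (0, 1, 0) 1"

definition var_z :: "'k::comm_ring_1 poly3" where
  "var_z = Poly_Mapping.single (0, 0, 1) 1"

text \<open>The standard grading.  Degrees are integers, so the components of negative degree
  are \<open>{0}\<close>.\<close>

definition homogeneous_component :: "int \<Rightarrow> 'k::comm_ring_1 poly3 set" where
  "homogeneous_component d = {p. \<forall>(i, j, k) \<in> Poly_Mapping.keys p. int (i + j + k) = d}"

text \<open>The grading that the quotient by a homogeneous ideal \<open>I\<close> inherits, as a family of sets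
  of cosets.\<close>

definition quotient_component :: "'k::comm_ring_1 poly3 set \<Rightarrow> int \<Rightarrow> 'k poly3 set set" where
  "quotient_component I d =
    (\<lambda>p. I +>\<^bsub>ring_of_type_algebra\<^esub> p) ` homogeneous_component d"

text \<open>Here \<open>G d\<close> is the component of degree \<open>d\<close> of \<open>Q\<close>.  The notion is only meant for artinian
  standard graded algebras \<open>Q\<close>.\<close>

definition weak_Lefschetz_property :: "('q, 'm) ring_scheme \<Rightarrow> (int \<Rightarrow> 'q set) \<Rightarrow> bool" where
  "weak_Lefschetz_property Q G \<longleftrightarrow>
    (\<exists>l \<in> G 1. \<forall>d.
      inj_on (\<lambda>u. l \<otimes>\<^bsub>Q\<^esub> u) (G d) \<or> (\<lambda>u. l \<otimes>\<^bsub>Q\<^esub> u) ` G d = G (d + 1))"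

text \<open>Binomial coefficients with an integer lower index, zero when that index is negative.\<close>

definition int_binomial :: "nat \<Rightarrow> int \<Rightarrow> int" where
  "int_binomial n k = (if k < 0 then 0 else int (n choose nat k))"

end

theory Submission
  imports Defs
begin

text \<open>
  Write \<open>I\<close> for the monomial ideal, \<open>E\<close> for the set of exponents of the monomials in \<open>I\<close>, and
  \<open>S\<close> for the integer \<open>s\<close> of the theorem.  Everything is decided by the single multiplication
  map from degree \<open>S\<close> to degree \<open>S + 1\<close> of \<open>R/I\<close>.

  The numerical hypotheses force \<open>R/I\<close> to have equal dimensions in the degrees \<open>S\<close> and \<open>S + 1\<close>
  (\<open>card_standard_monomials_eq\<close>), so in that degree ``injective or surjective'' means bijective.
  They also place the socle of \<open>R/I\<close> in degrees at least \<open>S\<close>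
  (\<open>standard_monomial_below_socle\<close>); hence injectivity in degree \<open>S\<close> descends to all lower
  degrees (\<open>mult_injective_pred\<close>), while surjectivity ascends to all higher degrees because \<open>R/I\<close>
  is generated in degree one (\<open>mult_surjective_Suc\<close>).

  Bijectivity in degree \<open>S\<close> is tested on the dual side, with Macaulay's inverse system.  A linear
  functional on the forms of degree \<open>S + 1\<close> is a function \<open>f\<close> on exponent triples of that degree;
  it kills \<open>I\<close> and all multiples of \<open>\<ell> = p x + q y + r z\<close> iff \<open>f\<close> vanishes on \<open>E\<close> and
  \<open>p f(i+1,j,k) + q f(i,j+1,k) + r f(i,j,k+1) = 0\<close> for \<open>i + j + k = S\<close>.  Multiplication by
  \<open>\<ell>\<close> is bijective iff \<open>f = 0\<close> is the only such function.

  Two changes of \<open>\<ell>\<close> reduce the existence of a good linear form to the case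
  \<open>\<ell> = x + y + z\<close>, both because \<open>I\<close> is generated by monomials: a zero coefficient can be
  replaced by \<open>1\<close> (\<open>no_annihilator_fill_zeros\<close>, a leading-term argument), and nonzero
  coefficients can be scaled to \<open>1\<close> (\<open>no_annihilator_rescale\<close>).

  For \<open>\<ell> = x + y + z\<close> the recurrence determines \<open>f\<close> from its values \<open>g(u) = f(u, S+1-u, 0)\<close> on one
  edge of the triangle, namely \<open>f(i,j,k)\<close> is \<open>(-1)^k\<close> times the sum of
  \<open>(k choose u-i) g(u)\<close> over \<open>u\<close>.  Vanishing on the multiples of \<open>x^a\<close> and \<open>y^b\<close> leaves the
  \<open>C + M\<close> unknowns \<open>g(u)\<close> with \<open>B \<le> u < a\<close>.  Vanishing on the multiples of \<open>z^c\<close> is a condition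
  on the layer \<open>k = c\<close> only, where it gives \<open>C\<close> equations; vanishing on the multiples of the
  mixed generator is likewise a condition on the layer \<open>k = \<gamma>\<close>, where it gives \<open>M\<close> equations.  The
  coefficient matrix of this square system, with the unknowns listed by decreasing \<open>u\<close>, is \<open>N\<close>
  (\<open>det_nonzero_iff_no_annihilator\<close>).
\<close>

section \<open>Square linear systems\<close>

definition injective_system :: "('y \<Rightarrow> 'x \<Rightarrow> 'k::field) \<Rightarrow> 'y set \<Rightarrow> 'x set \<Rightarrow> bool" where
  "injective_system E W V \<longleftrightarrow>
    (\<forall>f. (\<forall>y\<in>W. (\<Sum>x\<in>V. E y x * f x) = 0) \<longrightarrow> (\<forall>x\<in>V. f x = 0))"

definition surjective_system :: "('y \<Rightarrow> 'x \<Rightarrow> 'k::field) \<Rightarrow> 'y set \<Rightarrow> 'x set \<Rightarrow> bool" where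
  "surjective_system E W V \<longleftrightarrow>
    (\<forall>g. \<exists>f. \<forall>y\<in>W. (\<Sum>x\<in>V. E y x * f x) = g y)"

lemma det_nonzero_iff_injective_system:
  fixes A :: "'k::field mat"
  assumes A: "A \<in> carrier_mat n n"
  shows "det A \<noteq> 0 \<longleftrightarrow> injective_system (\<lambda>i j. A $$ (i, j)) {0..<n} {0..<n}"
proof -
  have mult: "(A *\<^sub>v vec n f) $ i = (\<Sum>j\<in>{0..<n}. A $$ (i, j) * f j)" if "i < n" for f i
    using A that by (auto simp: scalar_prod_def intro!: sum.cong)
  show ?thesis
  proof
    assume det: "det A \<noteq> 0"
    show "injective_system (\<lambda>i j. A $$ (i, j)) {0..<n} {0..<n}"
      unfolding injective_system_def
    proof (intro allI impI)
      fix f assume "\<forall>y\<in>{0..<n}. (\<Sum>x\<in>{0..<n}. A $$ (y, x) * f x) = 0"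
      then have "A *\<^sub>v vec n f = 0\<^sub>v n"
        using A mult by (intro eq_vecI) auto
      then have "vec n f = 0\<^sub>v n"
        using det det_0_iff_vec_prod_zero_field[OF A] by (meson vec_carrier)
      then have "vec n f $ j = 0" if "j < n" for j
        using that by simp
      then show "\<forall>x\<in>{0..<n}. f x = 0"
        by simp
    qed
  next
    assume inj: "injective_system (\<lambda>i j. A $$ (i, j)) {0..<n} {0..<n}"
    show "det A \<noteq> 0"
    proof
      assume "det A = 0"
      then obtain v where v: "v \<in> carrier_vec n" "v \<noteq> 0\<^sub>v n" "A *\<^sub>v v = 0\<^sub>v n"
        using det_0_iff_vec_prod_zero_field[OF A] by blast
      have vv: "v = vec n (\<lambda>j. v $ j)"
        using v(1) by auto
      have "\<forall>y\<in>{0..<n}. (\<Sum>x\<in>{0..<n}. A $$ (y, x) * v $ x) = 0"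
        using mult[of _ "\<lambda>j. v $ j"] v(3) vv by auto
      then have "\<forall>x\<in>{0..<n}. v $ x = 0"
        using inj unfolding injective_system_def by blast
      then show False
        using v(1,2) by (auto intro: eq_vecI)
    qed
  qed
qed

lemma injective_system_reindex:
  assumes "bij_betw \<eta> W' W" and "bij_betw \<xi> V' V"
  shows "injective_system E W V \<longleftrightarrow> injective_system (\<lambda>y x. E (\<eta> y) (\<xi> x)) W' V'"
proof -
  have sums: "(\<Sum>x\<in>V. E y x * f x) = (\<Sum>x\<in>V'. E y (\<xi> x) * f (\<xi> x))" for y f
    by (rule sum.reindex_bij_betw[OF assms(2), symmetric])
  have W: "W = \<eta> ` W'" and V: "V = \<xi> ` V'" and inj: "inj_on \<xi> V'"
    using assms by (auto simp: bij_betw_def)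
  show ?thesis
  proof
    assume l: "injective_system E W V"
    show "injective_system (\<lambda>y x. E (\<eta> y) (\<xi> x)) W' V'"
      unfolding injective_system_def
    proof (intro allI impI)
      fix f assume f: "\<forall>y\<in>W'. (\<Sum>x\<in>V'. E (\<eta> y) (\<xi> x) * f x) = 0"
      define f' where "f' = (\<lambda>x. f (inv_into V' \<xi> x))"
      have f': "f' (\<xi> x) = f x" if "x \<in> V'" for x
        using inj that by (simp add: f'_def)
      have "(\<Sum>x\<in>V. E y x * f' x) = 0" if "y \<in> W" for y
        using that f f' by (auto simp: sums W)
      then have "\<forall>x\<in>V. f' x = 0"
        using l unfolding injective_system_def by blast
      then show "\<forall>x\<in>V'. f x = 0"
        using f' V by auto
    qed
  next
    assume r: "injective_system (\<lambda>y x. E (\<eta> y) (\<xi> x)) W' V'"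
    show "injective_system E W V"
      unfolding injective_system_def
    proof (intro allI impI)
      fix f assume "\<forall>y\<in>W. (\<Sum>x\<in>V. E y x * f x) = 0"
      then have "\<forall>y\<in>W'. (\<Sum>x\<in>V'. E (\<eta> y) (\<xi> x) * f (\<xi> x)) = 0"
        by (auto simp: sums W)
      then show "\<forall>x\<in>V. f x = 0"
        using r[unfolded injective_system_def, rule_format, of "\<lambda>x. f (\<xi> x)"] V by auto
    qed
  qed
qed

text \<open>The two index sets have the same size, so enumerating them turns the system into a square
  matrix; transposition keeps its determinant, and a nonzero determinant provides an inverse.\<close>

lemma square_system:
  fixes E :: "'y \<Rightarrow> 'x \<Rightarrow> 'k::field"
  assumes "finite V" and "finite W" and "card V = card W"
  shows injective_iff_transpose: "injective_system E W V \<longleftrightarrow> injective_system (\<lambda>x y. E y x) V W"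
    and injective_imp_surjective: "injective_system E W V \<Longrightarrow> surjective_system E W V"
proof -
  define n where "n = card V"
  obtain \<xi> where \<xi>: "bij_betw \<xi> {0..<n} V"
    using ex_bij_betw_nat_finite[OF assms(1)] n_def by blast
  obtain \<eta> where \<eta>: "bij_betw \<eta> {0..<n} W"
    using ex_bij_betw_nat_finite[OF assms(2)] n_def assms(3) by auto
  define A where "A = mat n n (\<lambda>(i, j). E (\<eta> i) (\<xi> j))"
  have A: "A \<in> carrier_mat n n"
    by (simp add: A_def)
  have cong: "injective_system F {0..<n} {0..<n} = injective_system G {0..<n} {0..<n}"
    if "\<And>i j. i < n \<Longrightarrow> j < n \<Longrightarrow> F i j = G i j" for F G :: "nat \<Rightarrow> nat \<Rightarrow> 'k"
    using that by (simp add: injective_system_def)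
  have 1: "injective_system E W V \<longleftrightarrow> det A \<noteq> 0"
    unfolding injective_system_reindex[OF \<eta> \<xi>] det_nonzero_iff_injective_system[OF A]
    by (rule cong) (simp add: A_def)
  have 2: "injective_system (\<lambda>x y. E y x) V W \<longleftrightarrow> det (transpose_mat A) \<noteq> 0"
    unfolding injective_system_reindex[OF \<xi> \<eta>]
      det_nonzero_iff_injective_system[OF transpose_carrier_mat[THEN iffD2, OF A]]
    by (rule cong) (simp add: A_def)
  show "injective_system E W V \<longleftrightarrow> injective_system (\<lambda>x y. E y x) V W"
    unfolding 1 2 det_transpose[OF A] ..
  assume "injective_system E W V"
  then obtain B where B: "B \<in> carrier_mat n n" and AB: "A * B = 1\<^sub>m n"
    using det_non_zero_imp_unit[OF A, of "()"] 1 unfolding Units_def ring_mat_def by auto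
  show "surjective_system E W V"
    unfolding surjective_system_def
  proof
    fix g
    define w where "w = B *\<^sub>v vec n (\<lambda>i. g (\<eta> i))"
    define f where "f = (\<lambda>x. w $ inv_into {0..<n} \<xi> x)"
    have w: "w \<in> carrier_vec n"
      using B by (simp add: w_def)
    have Aw: "A *\<^sub>v w = vec n (\<lambda>i. g (\<eta> i))"
      unfolding w_def using A B AB
      by (metis assoc_mult_mat_vec one_mult_mat_vec vec_carrier)
    have f: "f (\<xi> j) = w $ j" if "j < n" for j
      using \<xi> that by (simp add: f_def bij_betw_def)
    have "(\<Sum>x\<in>V. E (\<eta> i) x * f x) = g (\<eta> i)" if i: "i < n" for i
    proof -
      have "(\<Sum>x\<in>V. E (\<eta> i) x * f x) = (\<Sum>j\<in>{0..<n}. E (\<eta> i) (\<xi> j) * f (\<xi> j))"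
        by (rule sum.reindex_bij_betw[OF \<xi>, symmetric])
      also have "\<dots> = (A *\<^sub>v w) $ i"
        using i w f by (auto simp: A_def scalar_prod_def intro!: sum.cong)
      finally show ?thesis
        using i by (simp add: Aw)
    qed
    then show "\<exists>f. \<forall>y\<in>W. (\<Sum>x\<in>V. E y x * f x) = g y"
      using \<eta> by (auto simp: bij_betw_def intro!: exI[of _ f])
  qed
qed

text \<open>Pair a solution \<open>g\<close> of the transposed system with a preimage of the unit vector at \<open>y0\<close>:
  the pairing is \<open>g y0\<close>, and it is zero.\<close>

lemma surjective_imp_transpose_injective:
  assumes "finite V" "finite W" and "surjective_system E W V"
  shows "injective_system (\<lambda>x y. E y x) V W"
  unfolding injective_system_def
proof (intro allI impI ballI)
  fix g y0 assume g: "\<forall>x\<in>V. (\<Sum>y\<in>W. E y x * g y) = 0" and y0: "y0 \<in> W"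
  obtain f where f: "\<forall>y\<in>W. (\<Sum>x\<in>V. E y x * f x) = (if y = y0 then 1 else 0)"
    using spec[OF assms(3)[unfolded surjective_system_def], of "\<lambda>y. if y = y0 then 1 else 0"]
    by blast
  have "g y0 = (\<Sum>y\<in>W. g y * (if y = y0 then 1 else 0))"
    using y0 assms(2) by (simp add: if_distrib cong: if_cong)
  also have "\<dots> = (\<Sum>y\<in>W. g y * (\<Sum>x\<in>V. E y x * f x))"
    using f by simp
  also have "\<dots> = (\<Sum>x\<in>V. f x * (\<Sum>y\<in>W. E y x * g y))"
    unfolding sum_distrib_left by (subst sum.swap) (simp add: mult_ac)
  also have "\<dots> = 0"
    using g by simp
  finally show "g y0 = 0" .
qed

section \<open>Functionals that annihilate a linear form\<close>

text \<open>The degree \<open>d + 1\<close> part of Macaulay's inverse system of the ideal generated by the monomials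
  with exponents in \<open>E\<close> and by \<open>p x + q y + r z\<close>: \<open>f i j k\<close> is the value of a linear functional
  on \<open>x^i y^j z^k\<close>.  Only the values with \<open>i + j + k = d + 1\<close> are constrained, so functions on all
  triples represent the functionals without being unique.\<close>

definition annihilates ::
    "(nat \<times> nat \<times> nat) set \<Rightarrow> 'k::field \<Rightarrow> 'k \<Rightarrow> 'k \<Rightarrow> nat \<Rightarrow> (nat \<Rightarrow> nat \<Rightarrow> nat \<Rightarrow> 'k) \<Rightarrow> bool" where
  "annihilates E p q r d f \<longleftrightarrow>
    (\<forall>i j k. i + j + k = Suc d \<longrightarrow> (i, j, k) \<in> E \<longrightarrow> f i j k = 0) \<and>
    (\<forall>i j k. i + j + k = d \<longrightarrow> p * f (Suc i) j k + q * f i (Suc j) k + r * f i j (Suc k) = 0)"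

definition no_annihilator :: "(nat \<times> nat \<times> nat) set \<Rightarrow> 'k::field \<Rightarrow> 'k \<Rightarrow> 'k \<Rightarrow> nat \<Rightarrow> bool" where
  "no_annihilator E p q r d \<longleftrightarrow>
    (\<forall>f. annihilates E p q r d f \<longrightarrow> (\<forall>i j k. i + j + k = Suc d \<longrightarrow> f i j k = 0))"

lemma no_annihilatorD:
  assumes "no_annihilator E p q r d" and "annihilates E p q r d f" and "i + j + k = Suc d"
  shows "f i j k = 0"
  using assms unfolding no_annihilator_def by blast

text \<open>Dual form of the coordinate change \<open>x \<mapsto> p x\<close>, \<open>y \<mapsto> q y\<close>, \<open>z \<mapsto> r z\<close>, which maps
  every monomial ideal to itself.\<close>

lemma no_annihilator_rescale:
  fixes p q r :: "'k::field"
  assumes nz: "p \<noteq> 0" "q \<noteq> 0" "r \<noteq> 0" and triv: "no_annihilator E p q r d"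
  shows "no_annihilator E (1::'k) 1 1 d"
  unfolding no_annihilator_def
proof (intro allI impI)
  fix f :: "nat \<Rightarrow> nat \<Rightarrow> nat \<Rightarrow> 'k" and i j k :: nat
  assume f: "annihilates E 1 1 1 d f" and deg: "i + j + k = Suc d"
  define f' where "f' = (\<lambda>i j k. f i j k / (p ^ i * q ^ j * r ^ k))"
  have "annihilates E p q r d f'"
    unfolding annihilates_def
  proof (intro conjI allI impI)
    fix i j k assume "i + j + k = Suc d" "(i, j, k) \<in> E"
    then show "f' i j k = 0"
      using f by (simp add: annihilates_def f'_def)
  next
    fix i j k assume "i + j + k = d"
    then have rel: "f (Suc i) j k + f i (Suc j) k + f i j (Suc k) = 0"
      using f by (simp add: annihilates_def)
    have "p * f' (Suc i) j k + q * f' i (Suc j) k + r * f' i j (Suc k)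
        = (f (Suc i) j k + f i (Suc j) k + f i j (Suc k)) / (p ^ i * q ^ j * r ^ k)"
      using nz by (simp add: f'_def add_divide_distrib mult.assoc)
    then show "p * f' (Suc i) j k + q * f' i (Suc j) k + r * f' i j (Suc k) = 0"
      by (simp add: rel)
  qed
  then have "f' i j k = 0"
    using no_annihilatorD[OF triv] deg by blast
  then show "f i j k = 0"
    using nz by (simp add: f'_def)
qed

text \<open>Give the variables with zero coefficient weight \<open>1\<close> and the others weight \<open>0\<close>.  The old linear
  form preserves the weight and the added variables raise it by \<open>1\<close>.  Hence the part of highest
  weight of an annihilator of the new form is an annihilator of the old one, so it is zero; the
  proof removes the weights one after the other, beginning with the highest.\<close>

lemma no_annihilator_fill_zeros:
  fixes p q r :: "'k::field"
  assumes triv: "no_annihilator E p q r d"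
  shows "no_annihilator E (if p = 0 then 1 else p) (if q = 0 then 1 else q) (if r = 0 then 1 else r) d"
proof -
  define w :: "nat \<Rightarrow> nat \<Rightarrow> nat \<Rightarrow> nat" where
    "w = (\<lambda>i j k. (if p = 0 then i else 0) + (if q = 0 then j else 0) + (if r = 0 then k else 0))"
  define p' q' r' where "p' = (if p = 0 then 1 else p)" "q' = (if q = 0 then 1 else q)"
    "r' = (if r = 0 then 1 else r)"
  have w_Suc: "w (Suc i) j k = (if p = 0 then Suc (w i j k) else w i j k)"
      "w i (Suc j) k = (if q = 0 then Suc (w i j k) else w i j k)"
      "w i j (Suc k) = (if r = 0 then Suc (w i j k) else w i j k)" for i j k
    by (simp_all add: w_def)
  have "no_annihilator E p' q' r' d"
    unfolding no_annihilator_def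
  proof (intro allI impI)
    fix f :: "nat \<Rightarrow> nat \<Rightarrow> nat \<Rightarrow> 'k" and i j k :: nat
    assume f: "annihilates E p' q' r' d f" and deg: "i + j + k = Suc d"
    \<comment> \<open>The functional vanishes in the \<open>n\<close> highest weights; weights are at most \<open>d + 1\<close>.\<close>
    have "\<forall>i j k. i + j + k = Suc d \<longrightarrow> Suc d < w i j k + n \<longrightarrow> f i j k = 0" for n
    proof (induction n)
      case 0
      have "w i j k \<le> i + j + k" for i j k
        by (auto simp: w_def)
      then show ?case
        by (metis add.right_neutral leD)
    next
      case (Suc n)
      \<comment> \<open>The part of weight \<open>d + 1 - n\<close>, the highest one that may still be nonzero.\<close>
      define top where "top = (\<lambda>i j k. if w i j k + n = Suc d then f i j k else 0)"
      have "annihilates E p q r d top"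
        unfolding annihilates_def
      proof (intro conjI allI impI)
        fix i j k assume "i + j + k = Suc d" "(i, j, k) \<in> E"
        then show "top i j k = 0"
          using f by (simp add: annihilates_def top_def)
      next
        fix i j k assume deg: "i + j + k = d"
        then have rel: "p' * f (Suc i) j k + q' * f i (Suc j) k + r' * f i j (Suc k) = 0"
          using f by (simp add: annihilates_def)
        show "p * top (Suc i) j k + q * top i (Suc j) k + r * top i j (Suc k) = 0"
        proof (cases "w i j k + n = Suc d")
          case False
          then have "p * top (Suc i) j k = 0" "q * top i (Suc j) k = 0" "r * top i j (Suc k) = 0"
            by (simp_all add: top_def w_Suc)
          then show ?thesis
            by (simp only: add.right_neutral)
        next
          case True
          have "p' * f (Suc i) j k = p * top (Suc i) j k"
          proof (cases "p = 0")
            case True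
            then have "f (Suc i) j k = 0"
              using Suc.IH \<open>w i j k + n = Suc d\<close> deg by (simp add: w_Suc)
            then show ?thesis
              using True by simp
          next
            case False
            then show ?thesis
              using \<open>w i j k + n = Suc d\<close> by (simp add: top_def w_Suc p'_q'_r'_def)
          qed
          moreover have "q' * f i (Suc j) k = q * top i (Suc j) k"
          proof (cases "q = 0")
            case True
            then have "f i (Suc j) k = 0"
              using Suc.IH \<open>w i j k + n = Suc d\<close> deg by (simp add: w_Suc)
            then show ?thesis
              using True by simp
          next
            case False
            then show ?thesis
              using \<open>w i j k + n = Suc d\<close> by (simp add: top_def w_Suc p'_q'_r'_def)
          qed
          moreover have "r' * f i j (Suc k) = r * top i j (Suc k)"
          proof (cases "r = 0")
            case True
            then have "f i j (Suc k) = 0"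
              using Suc.IH \<open>w i j k + n = Suc d\<close> deg by (simp add: w_Suc)
            then show ?thesis
              using True by simp
          next
            case False
            then show ?thesis
              using \<open>w i j k + n = Suc d\<close> by (simp add: top_def w_Suc p'_q'_r'_def)
          qed
          ultimately show ?thesis
            using rel by simp
        qed
      qed
      then have top: "top i j k = 0" if "i + j + k = Suc d" for i j k
        using no_annihilatorD[OF triv] that by blast
      show ?case
      proof (intro allI impI)
        fix i j k assume deg: "i + j + k = Suc d" and "Suc d < w i j k + Suc n"
        then consider "Suc d < w i j k + n" | "w i j k + n = Suc d" by linarith
        then show "f i j k = 0"
        proof cases
          case 1
          then show ?thesis using Suc.IH deg by blast
        next
          case 2
          then show ?thesis using top[OF deg] by (simp add: top_def)
        qed
      qed
    qed
    from this[of "Suc (Suc d)"] show "f i j k = 0"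
      using deg by simp
  qed
  then show ?thesis
    by (simp add: p'_q'_r'_def)
qed

lemma no_annihilator_sum_of_variables:
  fixes p q r :: "'k::field"
  assumes "no_annihilator E p q r d"
  shows "no_annihilator E (1::'k) 1 1 d"
  by (rule no_annihilator_rescale[OF _ _ _ no_annihilator_fill_zeros[OF assms]]) auto

section \<open>Annihilators of the sum of the variables\<close>

lemma int_binomial_0: "int_binomial 0 x = (if x = 0 then 1 else 0)"
  by (auto simp: int_binomial_def)

lemma int_binomial_Suc: "int_binomial (Suc k) x = int_binomial k x + int_binomial k (x - 1)"
proof (cases "x \<le> 0")
  case True
  then show ?thesis
    by (cases "x = 0") (auto simp: int_binomial_def)
next
  case False
  then obtain n where "x = int (Suc n)"
    by (metis gr0_conv_Suc not_le zero_less_imp_eq_int)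
  then show ?thesis
    by (simp add: int_binomial_def nat_add_distrib)
qed

lemma int_binomial_symmetric: "int_binomial k (int k - x) = int_binomial k x"
proof (cases "0 \<le> x \<and> x \<le> int k")
  case True
  then obtain n where n: "x = int n" "n \<le> k"
    by (metis nonneg_int_cases of_nat_le_iff)
  then have "nat (int k - int n) = k - n"
    by linarith
  then show ?thesis
    using n binomial_symmetric[OF n(2)] by (simp add: int_binomial_def)
next
  case False
  then show ?thesis
    by (auto simp: int_binomial_def binomial_eq_0)
qed

text \<open>The solution of \<open>f(i+1,j,k) + f(i,j+1,k) + f(i,j,k+1) = 0\<close> with \<open>f(i,j,0) = g(i)\<close>.  In a fixed
  degree \<open>j\<close> is determined by \<open>i\<close> and \<open>k\<close>, and is therefore dropped.\<close>

primrec lift_from_edge :: "(nat \<Rightarrow> 'k::comm_ring_1) \<Rightarrow> nat \<Rightarrow> nat \<Rightarrow> 'k" where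
  "lift_from_edge g 0 i = g i"
| "lift_from_edge g (Suc k) i = - (lift_from_edge g k i + lift_from_edge g k (Suc i))"

lemma annihilator_determined_by_edge:
  fixes f :: "nat \<Rightarrow> nat \<Rightarrow> nat \<Rightarrow> 'k::field"
  assumes f: "annihilates E 1 1 1 d f"
    and g: "\<And>u. u \<le> Suc d \<Longrightarrow> g u = f u (Suc d - u) 0"
    and "i + j + k = Suc d"
  shows "f i j k = lift_from_edge g k i"
  using assms(3)
proof (induction k arbitrary: i j)
  case 0
  then have "i \<le> Suc d" "Suc d - i = j" by simp_all
  then show ?case
    using g by simp
next
  case (Suc k)
  have "f (Suc i) j k + f i (Suc j) k + f i j (Suc k) = 0"
    using f Suc.prems by (simp add: annihilates_def)
  then have "f i j (Suc k) = - (f i (Suc j) k + f (Suc i) j k)"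
    by (simp only: eq_neg_iff_add_eq_0 add_ac)
  then show ?case
    using Suc.IH[of i "Suc j"] Suc.IH[of "Suc i" j] Suc.prems by simp
qed

text \<open>The layer \<open>k + 1\<close> at \<open>i\<close> combines the layer \<open>k\<close> at \<open>i\<close> and \<open>i + 1\<close>, which stay in the triangle
  \<open>lo \<le> i\<close>, \<open>i + k \<le> b\<close>.  So vanishing on the multiples of a monomial needs to be required
  only in the lowest layer that contains such multiples.\<close>

lemma lift_from_edge_zero_propagates:
  assumes "k0 \<le> k" and base: "\<And>i. lo \<le> i \<Longrightarrow> i + k0 \<le> b \<Longrightarrow> lift_from_edge g k0 i = 0"
    and "lo \<le> i" and "i + k \<le> b"
  shows "lift_from_edge g k i = 0"
  using assms(1,3,4)
proof (induction k arbitrary: i rule: dec_induct)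
  case base
  then show ?case
    using assms(2) by blast
next
  case (step k)
  then show ?case
    by simp
qed

text \<open>Induction on \<open>k\<close>: the recursion is Pascal's rule with a sign.\<close>

lemma lift_from_edge_eq_binomial_sum:
  fixes g :: "nat \<Rightarrow> 'k::comm_ring_1"
  assumes fin: "finite U" and supp: "\<And>u. u \<notin> U \<Longrightarrow> g u = 0"
  shows "lift_from_edge g k i = (- 1) ^ k * (\<Sum>u\<in>U. of_int (int_binomial k (int u - int i)) * g u)"
proof (induction k arbitrary: i)
  case 0
  have "(\<Sum>u\<in>U. of_int (int_binomial 0 (int u - int i)) * g u) = (\<Sum>u\<in>U. if u = i then g u else 0)"
    by (intro sum.cong) (auto simp: int_binomial_0)
  also have "\<dots> = g i"
    using fin supp by simp
  finally show ?case
    by simp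
next
  case (Suc k)
  have "int u - int (Suc i) = int u - int i - 1" for u
    by simp
  then show ?case
    by (simp only: lift_from_edge.simps Suc.IH int_binomial_Suc of_int_add distrib_right sum.distrib
        distrib_left power_Suc mult_minus_left minus_add_distrib mult_1_left)
qed

definition mixed_ideal_exponents ::
    "nat \<Rightarrow> nat \<Rightarrow> nat \<Rightarrow> nat \<Rightarrow> nat \<Rightarrow> nat \<Rightarrow> (nat \<times> nat \<times> nat) set" where
  "mixed_ideal_exponents a b c \<alpha> \<beta> \<gamma> =
    {(i, j, k). a \<le> i \<or> b \<le> j \<or> c \<le> k \<or> (\<alpha> \<le> i \<and> \<beta> \<le> j \<and> \<gamma> \<le> k)}"

lemma mem_mixed_ideal_exponents [simp]:
  "(i, j, k) \<in> mixed_ideal_exponents a b c \<alpha> \<beta> \<gamma> \<longleftrightarrow>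
    a \<le> i \<or> b \<le> j \<or> c \<le> k \<or> (\<alpha> \<le> i \<and> \<beta> \<le> j \<and> \<gamma> \<le> k)"
  by (simp add: mixed_ideal_exponents_def)

text \<open>The hypotheses of the theorem over the natural numbers, with \<open>S\<close> for \<open>s\<close>.  Among the \<open>S + 2\<close>
  monomials of degree \<open>S + 1\<close> in two variables, those divisible by a given monomial of degree \<open>a\<close>,
  \<open>b\<close>, \<open>c\<close> or \<open>\<alpha> + \<beta> + \<gamma>\<close> number \<open>A\<close>, \<open>B\<close>, \<open>C\<close> or \<open>M\<close>.  By \<open>total\<close> these four numbers
  add up to \<open>S + 2\<close>, which makes the final linear system square.\<close>

locale balanced_mixed_ideal =
  fixes a b c \<alpha> \<beta> \<gamma> S A B C M :: nat
  assumes less: "\<alpha> < a" "\<beta> < b" "\<gamma> < c"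
    and total: "a + b + c + \<alpha> + \<beta> + \<gamma> = 3 * S + 6"
    and complements: "a + A = S + 2" "b + B = S + 2" "c + C = S + 2" "\<alpha> + \<beta> + \<gamma> + M = S + 2"
    and bounds: "A \<le> \<beta> + \<gamma>" "B \<le> \<alpha> + \<gamma>" "C \<le> \<alpha> + \<beta>"
begin

abbreviation "E \<equiv> mixed_ideal_exponents a b c \<alpha> \<beta> \<gamma>"

text \<open>The matrix of the theorem with indices that start at \<open>0\<close>; the shift cancels in \<open>j - i\<close>.\<close>

definition N :: "int mat" where
  "N = mat (C + M) (C + M) (\<lambda>(i, j).
    if i < C then int_binomial c (int A + int j - int i)
    else int_binomial \<gamma> (int A + int C - int \<beta> + int j - int i))"

lemma a_eq: "a = B + (C + M)"
  using total complements by linarith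

text \<open>The column \<open>j\<close> of \<open>N\<close> belongs to the unknown at position \<open>u = a - 1 - j\<close> of the edge; outside
  \<open>B \<le> u < a\<close> the edge lies in the multiples of \<open>x^a\<close> or \<open>y^b\<close>, where the functional is zero.\<close>

definition edge :: "(nat \<Rightarrow> 'k::field) \<Rightarrow> nat \<Rightarrow> 'k" where
  "edge v u = (if B \<le> u \<and> u < a then v (a - 1 - u) else 0)"

text \<open>Up to sign, row \<open>r\<close> evaluates the functional at \<open>i = C - 1 - r\<close> in layer \<open>c\<close> if \<open>r < C\<close>, and at
  \<open>i = \<alpha> + (C + M - 1 - r)\<close> in layer \<open>\<gamma>\<close> otherwise.  These are the positions of the multiples of
  \<open>z^c\<close> and of the mixed generator in those layers.  The lower indices of the binomial
  coefficients agree after reflecting \<open>t\<close> to \<open>h - t\<close> in \<open>(h choose t)\<close>.\<close>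

lemma row_sum:
  fixes v :: "nat \<Rightarrow> 'k::field"
  assumes r: "r < C + M"
  shows "(\<Sum>j\<in>{0..<C + M}. of_int (N $$ (r, j)) * v j) =
    (if r < C then (- 1) ^ c * lift_from_edge (edge v) c (C - 1 - r)
     else (- 1) ^ \<gamma> * lift_from_edge (edge v) \<gamma> (\<alpha> + (C + M - 1 - r)))"
proof -
  define h where "h = (if r < C then c else \<gamma>)"
  define i where "i = (if r < C then C - 1 - r else \<alpha> + (C + M - 1 - r))"
  have entry: "N $$ (r, j) = int_binomial h (int (a - 1 - j) - int i)" if "j < C + M" for j
  proof (cases "r < C")
    case True
    have "int A + int j - int r = int c - (int (a - 1 - j) - int i)"
      using True that complements a_eq by (simp add: i_def)
    then show ?thesis
      using True that r by (simp add: N_def h_def int_binomial_symmetric)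
  next
    case False
    have "int A + int C - int \<beta> + int j - int r = int \<gamma> - (int (a - 1 - j) - int i)"
      using False r that complements a_eq by (simp add: i_def)
    then show ?thesis
      using False that r by (simp add: N_def h_def int_binomial_symmetric)
  qed
  \<comment> \<open>The columns run through the edge from its right end.\<close>
  have bij: "bij_betw (\<lambda>j. a - 1 - j) {0..<C + M} {B..<a}"
    by (rule bij_betw_byWitness[where f' = "\<lambda>u. a - 1 - u"]) (use a_eq in auto)
  have "(\<Sum>j\<in>{0..<C + M}. of_int (N $$ (r, j)) * v j) =
      (\<Sum>j\<in>{0..<C + M}. of_int (int_binomial h (int (a - 1 - j) - int i)) * edge v (a - 1 - j))"
  proof (intro sum.cong refl)
    fix j assume "j \<in> {0..<C + M}"
    then have "j < C + M" "B \<le> a - 1 - j" "a - 1 - j < a" "a - 1 - (a - 1 - j) = j"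
      using a_eq by auto
    then show "of_int (N $$ (r, j)) * v j
        = of_int (int_binomial h (int (a - 1 - j) - int i)) * edge v (a - 1 - j)"
      by (simp only: entry edge_def) simp
  qed
  also have "\<dots> = (\<Sum>u\<in>{B..<a}. of_int (int_binomial h (int u - int i)) * edge v u)"
    by (rule sum.reindex_bij_betw[OF bij])
  also have "\<dots> = (- 1) ^ h * lift_from_edge (edge v) h i"
    by (subst lift_from_edge_eq_binomial_sum[of "{B..<a}"])
      (auto simp: edge_def simp flip: mult.assoc power_mult_distrib)
  finally show ?thesis
    by (simp add: h_def i_def)
qed

text \<open>Annihilators of degree \<open>S + 1\<close> correspond to solutions of \<open>N v = 0\<close>: an annihilator is
  restricted to its edge, and a solution is extended from the edge by the recursion.\<close>

lemma det_nonzero_iff_no_annihilator: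
  "of_int (det N) \<noteq> (0::'k::field) \<longleftrightarrow> no_annihilator E (1::'k) 1 1 S"
proof -
  let ?n = "C + M"
  let ?A = "map_mat of_int N :: 'k mat"
  have N: "N \<in> carrier_mat ?n ?n"
    by (simp add: N_def)
  have "of_int (det N) \<noteq> (0::'k) \<longleftrightarrow> det ?A \<noteq> 0"
    by (simp add: of_int_hom.hom_det)
  also have "\<dots> \<longleftrightarrow> injective_system (\<lambda>i j. ?A $$ (i, j)) {0..<?n} {0..<?n}"
    using N by (intro det_nonzero_iff_injective_system) simp
  also have "\<dots> \<longleftrightarrow> injective_system (\<lambda>i j. of_int (N $$ (i, j)) :: 'k) {0..<?n} {0..<?n}"
    using N by (simp add: injective_system_def)
  also have "\<dots> \<longleftrightarrow> no_annihilator E (1::'k) 1 1 S"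
  proof
    assume inj: "injective_system (\<lambda>i j. of_int (N $$ (i, j)) :: 'k) {0..<?n} {0..<?n}"
    show "no_annihilator E (1::'k) 1 1 S"
      unfolding no_annihilator_def
    proof (intro allI impI)
      fix f :: "nat \<Rightarrow> nat \<Rightarrow> nat \<Rightarrow> 'k" and i j k :: nat
      assume f: "annihilates E 1 1 1 S f" and deg: "i + j + k = Suc S"
      have vanish: "f i j k = 0" if "i + j + k = Suc S" "(i, j, k) \<in> E" for i j k
        using f that unfolding annihilates_def by blast
      define v where "v = (\<lambda>j. f (a - 1 - j) (Suc S - (a - 1 - j)) 0)"
      have edge: "edge v u = f u (Suc S - u) 0" if "u \<le> Suc S" for u
      proof (cases "B \<le> u \<and> u < a")
        case True
        then have "a - 1 - (a - 1 - u) = u" by linarith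
        then show ?thesis
          using True by (simp add: edge_def v_def)
      next
        case False
        then have "(u, Suc S - u, 0) \<in> E"
          using complements by auto
        then have "f u (Suc S - u) 0 = 0"
          using that by (intro vanish) auto
        then show ?thesis
          using False by (auto simp: edge_def)
      qed
      have ext: "f i j k = lift_from_edge (edge v) k i" if "i + j + k = Suc S" for i j k
        using edge that by (rule annihilator_determined_by_edge[OF f])
      have "\<forall>r\<in>{0..<?n}. (\<Sum>j\<in>{0..<?n}. of_int (N $$ (r, j)) * v j) = 0"
      proof
        fix r assume "r \<in> {0..<?n}"
        then have r: "r < ?n" by simp
        show "(\<Sum>j\<in>{0..<?n}. of_int (N $$ (r, j)) * v j) = 0"
        proof (cases "r < C")
          case True
          have "C - 1 - r + r + c = Suc S"
            using True complements(3) by simp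
          then have "lift_from_edge (edge v) c (C - 1 - r) = f (C - 1 - r) r c"
            by (rule ext[symmetric])
          also have "\<dots> = 0"
            using True complements by (intro vanish) auto
          finally show ?thesis
            using True r by (simp add: row_sum)
        next
          case False
          have "\<alpha> + (?n - 1 - r) + (\<beta> + (r - C)) + \<gamma> = Suc S"
            using False r complements(4) by simp
          then have "lift_from_edge (edge v) \<gamma> (\<alpha> + (?n - 1 - r)) = f (\<alpha> + (?n - 1 - r)) (\<beta> + (r - C)) \<gamma>"
            by (rule ext[symmetric])
          also have "\<dots> = 0"
            using False r complements by (intro vanish) auto
          finally show ?thesis
            using False r by (simp add: row_sum)
        qed
      qed
      then have "\<forall>j\<in>{0..<?n}. v j = 0"
        using inj unfolding injective_system_def by blast
      moreover have "a - 1 - u \<in> {0..<?n}" if "B \<le> u" "u < a" for u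
        using that a_eq by simp
      ultimately have "edge v u = 0" for u
        unfolding edge_def by presburger
      then have "lift_from_edge (edge v) k i = 0"
        by (intro lift_from_edge_zero_propagates[of 0 k 0 "i + k"]) auto
      then show "f i j k = 0"
        using ext[OF deg] by simp
    qed
  next
    assume triv: "no_annihilator E (1::'k) 1 1 S"
    show "injective_system (\<lambda>i j. of_int (N $$ (i, j)) :: 'k) {0..<?n} {0..<?n}"
      unfolding injective_system_def
    proof (intro allI impI ballI)
      fix v :: "nat \<Rightarrow> 'k" and j
      assume rows: "\<forall>r\<in>{0..<?n}. (\<Sum>j\<in>{0..<?n}. of_int (N $$ (r, j)) * v j) = 0"
        and j: "j \<in> {0..<?n}"
      \<comment> \<open>The \<open>C\<close> and \<open>M\<close> rows give vanishing in the lowest layers \<open>k = c\<close> and \<open>k = \<gamma>\<close>; in the case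
        analysis on \<open>(i, j, k) \<in> E\<close> below it propagates to the layers above them.\<close>
      have c_row: "lift_from_edge (edge v) c i = 0" if "i + c \<le> Suc S" for i
      proof -
        have i: "i < C" "C - 1 - (C - 1 - i) = i"
          using that complements by linarith+
        then have "(- 1) ^ c * lift_from_edge (edge v) c i = 0"
          using rows row_sum[of "C - 1 - i" v] by simp
        then show ?thesis
          by simp
      qed
      have \<gamma>_row: "lift_from_edge (edge v) \<gamma> i = 0" if "\<alpha> \<le> i" "i + \<gamma> \<le> Suc S - \<beta>" "\<beta> \<le> Suc S" for i
      proof -
        define r where "r = ?n - 1 - (i - \<alpha>)"
        have "r < ?n" "\<not> r < C" "\<alpha> + (?n - 1 - r) = i"
          using that complements unfolding r_def by linarith+
        then have "(- 1) ^ \<gamma> * lift_from_edge (edge v) \<gamma> i = 0"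
          using rows row_sum[of r v] by simp
        then show ?thesis
          by simp
      qed
      define f where "f = (\<lambda>(i::nat) (j::nat) (k::nat). lift_from_edge (edge v) k i)"
      have "annihilates E 1 1 1 S f"
        unfolding annihilates_def
      proof (intro conjI allI impI)
        fix i j k assume deg: "i + j + k = Suc S" and "(i, j, k) \<in> E"
        then consider "a \<le> i" | "b \<le> j" | "c \<le> k" | "\<alpha> \<le> i" "\<beta> \<le> j" "\<gamma> \<le> k"
          by auto
        then show "f i j k = 0"
          unfolding f_def
        proof cases
          case 1
          then show "lift_from_edge (edge v) k i = 0"
            by (intro lift_from_edge_zero_propagates[of 0 k a "i + k"]) (auto simp: edge_def)
        next
          case 2
          then show "lift_from_edge (edge v) k i = 0"
            using deg complements
            by (intro lift_from_edge_zero_propagates[of 0 k 0 "i + k"]) (auto simp: edge_def)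
        next
          case 3
          then show "lift_from_edge (edge v) k i = 0"
            using deg c_row by (intro lift_from_edge_zero_propagates[of c k 0 "Suc S"]) auto
        next
          case 4
          then show "lift_from_edge (edge v) k i = 0"
            using deg \<gamma>_row by (intro lift_from_edge_zero_propagates[of \<gamma> k \<alpha> "Suc S - \<beta>"]) auto
        qed
      qed (simp add: f_def)
      then have "f (a - 1 - j) (Suc S - (a - 1 - j)) 0 = 0"
        using complements less by (intro no_annihilatorD[OF triv]) auto
      then have "edge v (a - 1 - j) = 0"
        by (simp add: f_def)
      moreover have "B \<le> a - 1 - j" "a - 1 - j < a" "a - 1 - (a - 1 - j) = j"
        using j a_eq by auto
      ultimately show "v j = 0"
        by (simp add: edge_def)
    qed
  qed
  finally show ?thesis .
qed

end

section \<open>Standard monomials of the mixed ideal\<close>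

definition standard_monomials :: "(nat \<times> nat \<times> nat) set \<Rightarrow> nat \<Rightarrow> (nat \<times> nat \<times> nat) set" where
  "standard_monomials E d = {(i, j, k). i + j + k = d \<and> (i, j, k) \<notin> E}"

lemma mem_standard_monomials [simp]:
  "(i, j, k) \<in> standard_monomials E d \<longleftrightarrow> i + j + k = d \<and> (i, j, k) \<notin> E"
  by (simp add: standard_monomials_def)

lemma finite_standard_monomials [simp]: "finite (standard_monomials E d)"
  by (rule finite_subset[of _ "{..d} \<times> {..d} \<times> {..d}"]) (auto simp: standard_monomials_def)

context balanced_mixed_ideal
begin

text \<open>Multiply the standard monomials of degree \<open>S\<close> by \<open>z\<close> and compare the result with the standard
  monomials of degree \<open>S + 1\<close>.  The latter have the additional members \<open>(i, j, 0)\<close>, the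
  \<open>bottom\<close>; the former have additional members that entered the ideal, the tops, which lie at
  height \<open>\<gamma>\<close> over the quadrant \<open>\<alpha> \<le> i\<close>, \<open>\<beta> \<le> j\<close> and at height \<open>c\<close> elsewhere.  By the numerical
  hypotheses \<open>i\<close> runs through a full interval in each case: there are \<open>a - B = C + M\<close> bottoms,
  \<open>C\<close> tops at height \<open>c\<close>, and \<open>M\<close> tops at height \<open>\<gamma>\<close>.\<close>

lemma card_standard_monomials_eq:
  "card (standard_monomials E (Suc S)) = card (standard_monomials E S)"
proof -
  define shifted where "shifted = (\<lambda>(i, j, k). (i, j, Suc k)) ` standard_monomials E S"
  define bottom where "bottom = (\<lambda>i. (i, Suc S - i, 0::nat)) ` {B..<a}"
  define tops1 where "tops1 = (\<lambda>i. (i, C - 1 - i, c)) ` {..<C}"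
  define tops2 where "tops2 = (\<lambda>i. (i, Suc S - \<gamma> - i, \<gamma>)) ` {\<alpha>..<\<alpha> + M}"
  have mem_shifted: "(i, j, k) \<in> shifted \<longleftrightarrow>
      (\<exists>k'. k = Suc k' \<and> i + j + k' = S \<and> (i, j, k') \<notin> E)" for i j k
    by (force simp: shifted_def standard_monomials_def image_iff)
  have mem_bottom: "(i, j, k) \<in> bottom \<longleftrightarrow> k = 0 \<and> i + j = Suc S \<and> i < a \<and> j < b" for i j k
    using complements by (auto simp: bottom_def image_iff)
  have mem_tops1: "(i, j, k) \<in> tops1 \<longleftrightarrow>
      k = c \<and> i + j + c = Suc S \<and> i < a \<and> j < b \<and> \<not> (\<alpha> \<le> i \<and> \<beta> \<le> j)" for i j k
    using complements total bounds by (auto simp: tops1_def image_iff)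
  have mem_tops2: "(i, j, k) \<in> tops2 \<longleftrightarrow>
      k = \<gamma> \<and> i + j + \<gamma> = Suc S \<and> i < a \<and> j < b \<and> \<alpha> \<le> i \<and> \<beta> \<le> j" for i j k
    using complements total bounds by (auto simp: tops2_def image_iff)
  \<comment> \<open>If \<open>\<gamma> = 0\<close>, then \<open>(i, j, 0)\<close> over the quadrant is in the ideal and is both a bottom and a top.\<close>
  have union: "standard_monomials E (Suc S) \<union> (tops1 \<union> tops2) = shifted \<union> bottom"
  proof (rule Set.set_eqI)
    fix m :: "nat \<times> nat \<times> nat"
    obtain i j k where m: "m = (i, j, k)"
      by (cases m) auto
    show "m \<in> standard_monomials E (Suc S) \<union> (tops1 \<union> tops2) \<longleftrightarrow> m \<in> shifted \<union> bottom"
      unfolding m using less by (cases k) (auto simp: mem_shifted mem_bottom mem_tops1 mem_tops2)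
  qed
  have "card (standard_monomials E (Suc S)) + (C + M)
      = card (standard_monomials E (Suc S)) + card (tops1 \<union> tops2)"
  proof -
    have "tops1 \<inter> tops2 = {}"
      using less by (auto simp: mem_tops1 mem_tops2)
    moreover have "card tops1 = C" "card tops2 = M"
      by (simp_all add: tops1_def tops2_def card_image inj_on_def)
    moreover have "finite tops1" "finite tops2"
      by (simp_all add: tops1_def tops2_def)
    ultimately show ?thesis
      by (simp add: card_Un_disjoint)
  qed
  also have "\<dots> = card (standard_monomials E (Suc S) \<union> (tops1 \<union> tops2))"
  proof (rule card_Un_disjoint[symmetric])
    show "standard_monomials E (Suc S) \<inter> (tops1 \<union> tops2) = {}"
      by (auto simp: mem_tops1 mem_tops2)
    show "finite (tops1 \<union> tops2)"
      by (simp add: tops1_def tops2_def)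
  qed simp
  also have "\<dots> = card shifted + card bottom"
    unfolding union
  proof (rule card_Un_disjoint)
    show "shifted \<inter> bottom = {}"
      by (auto simp: mem_shifted mem_bottom)
    show "finite shifted" "finite bottom"
      by (simp_all add: shifted_def bottom_def)
  qed
  also have "card shifted = card (standard_monomials E S)"
    unfolding shifted_def by (rule card_image) (auto simp: inj_on_def)
  also have "card bottom = C + M"
    unfolding bottom_def using a_eq by (subst card_image) (auto simp: inj_on_def)
  finally show ?thesis
    by simp
qed

text \<open>A socle monomial of \<open>R/I\<close> is \<open>x^(a-1) y^(b-1) z^(\<gamma>-1)\<close> or one of its two analogues.  As
  \<open>c \<le> S + 2\<close> and \<open>\<alpha> + \<beta> + \<gamma> \<le> S + 2\<close>, the total gives \<open>S + 2 \<le> a + b\<close>, so that with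
  \<open>\<gamma> \<ge> 1\<close> its degree is at least \<open>S\<close>; the analogues are similar.\<close>

lemma standard_monomial_below_socle:
  assumes "(i, j, k) \<notin> E" and "i + j + k < S"
  shows "(Suc i, j, k) \<notin> E \<or> (i, Suc j, k) \<notin> E \<or> (i, j, Suc k) \<notin> E"
proof (rule ccontr)
  assume "\<not> ?thesis"
  moreover have "i < a" "j < b" "k < c" "i < \<alpha> \<or> j < \<beta> \<or> k < \<gamma>"
    using assms(1) by auto
  moreover have "S + 2 \<le> a + b" "S + 2 \<le> a + c" "S + 2 \<le> b + c"
    using total complements by linarith+
  ultimately show False
    using assms(2) by auto
qed

end

section \<open>Monomial ideals and their graded quotients\<close>

abbreviation poly3_ring :: "'k::field poly3 ring" where
  "poly3_ring \<equiv> ring_of_type_algebra"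

lemma poly3_ring_simps [simp]:
  "carrier poly3_ring = UNIV"
  "p \<otimes>\<^bsub>poly3_ring\<^esub> q = p * q"
  "p \<oplus>\<^bsub>poly3_ring\<^esub> q = p + q"
  "\<zero>\<^bsub>poly3_ring\<^esub> = 0"
  "\<one>\<^bsub>poly3_ring\<^esub> = 1"
  by (simp_all add: ring_of_type_algebra_def)

lemma cring_poly3_ring: "cring (poly3_ring :: 'k::field poly3 ring)"
  by (rule cring_from_type_algebra)

lemma ring_poly3_ring: "ring (poly3_ring :: 'k::field poly3 ring)"
  by (rule ring_from_type_algebra)

lemma poly3_ring_uminus [simp]: "\<ominus>\<^bsub>poly3_ring\<^esub> p = - (p :: 'k::field poly3)"
proof -
  interpret R: cring "poly3_ring :: 'k poly3 ring"
    by (rule cring_poly3_ring)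
  show ?thesis
    by (rule R.minus_equality) simp_all
qed

lemma poly3_ring_minus [simp]: "p \<ominus>\<^bsub>poly3_ring\<^esub> q = (p - q :: 'k::field poly3)"
  by (simp add: a_minus_def)

definition monomial_ideal :: "(nat \<times> nat \<times> nat) set \<Rightarrow> 'k::field poly3 set" where
  "monomial_ideal E = {p. Poly_Mapping.keys p \<subseteq> E}"

definition upward_closed :: "(nat \<times> nat \<times> nat) set \<Rightarrow> bool" where
  "upward_closed E \<longleftrightarrow> (\<forall>m\<in>E. \<forall>n. n + m \<in> E)"

lemma upward_closed_mixed_ideal_exponents:
  "upward_closed (mixed_ideal_exponents a b c \<alpha> \<beta> \<gamma>)"
  by (auto simp: upward_closed_def mixed_ideal_exponents_def)

lemma mem_monomial_ideal_iff:
  "p \<in> monomial_ideal E \<longleftrightarrow> (\<forall>m. m \<notin> E \<longrightarrow> Poly_Mapping.lookup p m = 0)"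
  by (auto simp: monomial_ideal_def in_keys_iff)

lemma monomial_ideal_mult:
  assumes "upward_closed E" and "p \<in> monomial_ideal E"
  shows "u * p \<in> monomial_ideal E"
  using assms keys_mult[of u p] unfolding monomial_ideal_def upward_closed_def by blast

lemma ideal_monomial_ideal:
  assumes "upward_closed E"
  shows "ideal (monomial_ideal E :: 'k::field poly3 set) poly3_ring"
proof -
  interpret R: cring "poly3_ring :: 'k poly3 ring"
    by (rule cring_poly3_ring)
  have "subgroup (monomial_ideal E) (add_monoid (poly3_ring :: 'k poly3 ring))"
  proof (rule R.add.subgroupI)
    show "monomial_ideal E \<noteq> ({} :: 'k poly3 set)"
      by (auto simp: monomial_ideal_def intro!: exI[of _ 0])
  qed (auto simp: mem_monomial_ideal_iff lookup_add simp flip: a_inv_def)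
  moreover have "u * p \<in> monomial_ideal E \<and> p * u \<in> monomial_ideal E"
    if "p \<in> monomial_ideal E" for p u :: "'k poly3"
    using monomial_ideal_mult[OF assms that, of u] by (simp add: mult.commute)
  ultimately show ?thesis
    by (intro idealI ring_poly3_ring) auto
qed

lemma sum_of_monomials:
  assumes "finite T" and "Poly_Mapping.keys p \<subseteq> T"
  shows "p = (\<Sum>m\<in>T. Poly_Mapping.single m (Poly_Mapping.lookup p m))"
proof (rule poly_mapping_eqI)
  fix m
  have "Poly_Mapping.lookup (\<Sum>m\<in>T. Poly_Mapping.single m (Poly_Mapping.lookup p m)) m
      = (\<Sum>m'\<in>T. if m' = m then Poly_Mapping.lookup p m else 0)"
    unfolding lookup_sum by (intro sum.cong) (auto simp: lookup_single)
  also have "\<dots> = Poly_Mapping.lookup p m"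
    using assms by (auto simp: in_keys_iff)
  finally show "Poly_Mapping.lookup p m =
      Poly_Mapping.lookup (\<Sum>m\<in>T. Poly_Mapping.single m (Poly_Mapping.lookup p m)) m" ..
qed

lemma sum_closed_set:
  assumes "finite T" and "0 \<in> J" and "\<And>p q. p \<in> J \<Longrightarrow> q \<in> J \<Longrightarrow> p + q \<in> J"
    and "\<And>m. m \<in> T \<Longrightarrow> f m \<in> J"
  shows "(\<Sum>m\<in>T. f m) \<in> (J :: 'a::comm_monoid_add set)"
  using assms(1,4) by (induction T rule: finite_induct) (auto intro: assms(2,3))

lemma var_powers:
  "var_x ^ n = (Poly_Mapping.single (n, 0, 0) 1 :: 'k::field poly3)"
  "var_y ^ n = (Poly_Mapping.single (0, n, 0) 1 :: 'k::field poly3)"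
  "var_z ^ n = (Poly_Mapping.single (0, 0, n) 1 :: 'k::field poly3)"
proof -
  have one: "Poly_Mapping.single (0, 0, 0) 1 = (1 :: 'k poly3)"
    using single_one[where 'a = "nat \<times> nat \<times> nat"] by (simp add: zero_prod_def)
  show "var_x ^ n = (Poly_Mapping.single (n, 0, 0) 1 :: 'k::field poly3)"
    by (induction n) (simp_all add: one var_x_def mult_single)
  show "var_y ^ n = (Poly_Mapping.single (0, n, 0) 1 :: 'k::field poly3)"
    by (induction n) (simp_all add: one var_y_def mult_single)
  show "var_z ^ n = (Poly_Mapping.single (0, 0, n) 1 :: 'k::field poly3)"
    by (induction n) (simp_all add: one var_z_def mult_single)
qed

lemma genideal_eq_monomial_ideal:
  "Idl\<^bsub>poly3_ring\<^esub> {var_x ^ a, var_y ^ b, var_z ^ c, var_x ^ \<alpha> * var_y ^ \<beta> * var_z ^ \<gamma>} =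
    (monomial_ideal (mixed_ideal_exponents a b c \<alpha> \<beta> \<gamma>) :: 'k::field poly3 set)"
    (is "Idl\<^bsub>_\<^esub> ?G = monomial_ideal ?E")
proof
  interpret R: cring "poly3_ring :: 'k poly3 ring"
    by (rule cring_poly3_ring)
  have mixed: "var_x ^ \<alpha> * var_y ^ \<beta> * var_z ^ \<gamma> = (Poly_Mapping.single (\<alpha>, \<beta>, \<gamma>) 1 :: 'k poly3)"
    by (simp add: var_powers mult_single)
  show "Idl\<^bsub>poly3_ring\<^esub> ?G \<subseteq> (monomial_ideal ?E :: 'k poly3 set)"
  proof (rule R.genideal_minimal)
    show "ideal (monomial_ideal ?E :: 'k poly3 set) poly3_ring"
      by (rule ideal_monomial_ideal[OF upward_closed_mixed_ideal_exponents])
    show "?G \<subseteq> (monomial_ideal ?E :: 'k poly3 set)"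
      unfolding mixed unfolding var_powers by (auto simp: monomial_ideal_def)
  qed
  interpret J: ideal "Idl\<^bsub>poly3_ring\<^esub> ?G :: 'k poly3 set" poly3_ring
    by (rule R.genideal_ideal) simp
  have gens: "?G \<subseteq> (Idl\<^bsub>poly3_ring\<^esub> ?G :: 'k poly3 set)"
    by (rule R.genideal_self) simp
  have multiple: "Poly_Mapping.single (n + g) x \<in> Idl\<^bsub>poly3_ring\<^esub> ?G"
    if "Poly_Mapping.single g 1 \<in> ?G" for n g and x :: 'k
  proof -
    have "Poly_Mapping.single n x * Poly_Mapping.single g 1 \<in> Idl\<^bsub>poly3_ring\<^esub> ?G"
      using J.I_l_closed[of "Poly_Mapping.single g 1" "Poly_Mapping.single n x"] gens that by auto
    then show ?thesis
      by (simp add: mult_single)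
  qed
  have monomial: "Poly_Mapping.single m x \<in> Idl\<^bsub>poly3_ring\<^esub> ?G" if m: "m \<in> ?E" for m and x :: 'k
  proof -
    obtain i j k where ijk: "m = (i, j, k)"
      by (cases m) auto
    then consider "a \<le> i" | "b \<le> j" | "c \<le> k" | "\<alpha> \<le> i" "\<beta> \<le> j" "\<gamma> \<le> k"
      using m by auto
    then show ?thesis
    proof cases
      case 1
      then show ?thesis
        using multiple[of "(a, 0, 0)" "(i - a, j, k)" x] by (simp add: ijk var_powers)
    next
      case 2
      then show ?thesis
        using multiple[of "(0, b, 0)" "(i, j - b, k)" x] by (simp add: ijk var_powers)
    next
      case 3
      then show ?thesis
        using multiple[of "(0, 0, c)" "(i, j, k - c)" x] by (simp add: ijk var_powers)
    next
      case 4
      then show ?thesis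
        using multiple[of "(\<alpha>, \<beta>, \<gamma>)" "(i - \<alpha>, j - \<beta>, k - \<gamma>)" x] by (simp add: ijk mixed)
    qed
  qed
  show "(monomial_ideal ?E :: 'k poly3 set) \<subseteq> Idl\<^bsub>poly3_ring\<^esub> ?G"
  proof
    fix p :: "'k poly3" assume p: "p \<in> monomial_ideal ?E"
    have "(\<Sum>m\<in>Poly_Mapping.keys p. Poly_Mapping.single m (Poly_Mapping.lookup p m)) \<in> Idl\<^bsub>poly3_ring\<^esub> ?G"
      using p J.a_closed J.zero_closed
      by (intro sum_closed_set) (auto simp: monomial_ideal_def intro!: monomial)
    then show "p \<in> Idl\<^bsub>poly3_ring\<^esub> ?G"
      using sum_of_monomials[of "Poly_Mapping.keys p" p] by simp
  qed
qed

definition mult_injective :: "'k::field poly3 set \<Rightarrow> 'k poly3 \<Rightarrow> int \<Rightarrow> bool" where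
  "mult_injective I L d \<longleftrightarrow> (\<forall>u\<in>homogeneous_component d. L * u \<in> I \<longrightarrow> u \<in> I)"

definition mult_surjective :: "'k::field poly3 set \<Rightarrow> 'k poly3 \<Rightarrow> int \<Rightarrow> bool" where
  "mult_surjective I L d \<longleftrightarrow>
    (\<forall>v\<in>homogeneous_component (d + 1). \<exists>u\<in>homogeneous_component d. v - L * u \<in> I)"

lemma homogeneous_component_closed:
  assumes "p \<in> homogeneous_component d" "q \<in> homogeneous_component d"
  shows "p + q \<in> homogeneous_component d" and "p - q \<in> homogeneous_component d"
  using assms keys_add[of p q] keys_diff[of p q] unfolding homogeneous_component_def by blast+

lemma homogeneous_component_mult:
  assumes p: "p \<in> homogeneous_component d" and q: "q \<in> homogeneous_component e"
  shows "p * q \<in> homogeneous_component (d + e)"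
proof -
  have "case m of (i, j, k) \<Rightarrow> int (i + j + k) = d + e" if "m \<in> Poly_Mapping.keys (p * q)" for m
  proof -
    obtain m1 m2 where m: "m = m1 + m2" "m1 \<in> Poly_Mapping.keys p" "m2 \<in> Poly_Mapping.keys q"
      using keys_mult[of p q] \<open>m \<in> _\<close> by blast
    then show ?thesis
      using p q unfolding homogeneous_component_def by (cases m1; cases m2) fastforce
  qed
  then show ?thesis
    by (auto simp: homogeneous_component_def)
qed

text \<open>This removes the cosets: injectivity and surjectivity on a graded piece of the quotient are
  tested on homogeneous representatives modulo \<open>I\<close>.\<close>

lemma quotient_weak_Lefschetz_property:
  fixes I :: "'k::field poly3 set"
  assumes I: "ideal I poly3_ring"
  shows "weak_Lefschetz_property (poly3_ring Quot I) (quotient_component I) \<longleftrightarrow>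
    (\<exists>L\<in>homogeneous_component 1. \<forall>d. mult_injective I L d \<or> mult_surjective I L d)"
proof -
  interpret I: ideal I "poly3_ring :: 'k poly3 ring"
    by (rule I)
  let ?q = "\<lambda>p :: 'k poly3. I +>\<^bsub>poly3_ring\<^esub> p"
  have eq: "?q p = ?q q \<longleftrightarrow> p - q \<in> I" for p q
    using I.quotient_eq_iff_same_a_r_cos[OF I, of p q] by simp
  have mult: "?q p \<otimes>\<^bsub>poly3_ring Quot I\<^esub> ?q q = ?q (p * q)" for p q
    using I.rcoset_mult_add[of p q] by (simp add: FactRing_def)
  have inj: "inj_on (\<lambda>u. ?q L \<otimes>\<^bsub>poly3_ring Quot I\<^esub> u) (quotient_component I d) \<longleftrightarrow> mult_injective I L d"
    for L d
  proof
    assume inj: "inj_on (\<lambda>u. ?q L \<otimes>\<^bsub>poly3_ring Quot I\<^esub> u) (quotient_component I d)"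
    show "mult_injective I L d"
      unfolding mult_injective_def
    proof (intro ballI impI)
      fix u assume u: "u \<in> homogeneous_component d" and "L * u \<in> I"
      then have "?q L \<otimes>\<^bsub>poly3_ring Quot I\<^esub> ?q u = ?q L \<otimes>\<^bsub>poly3_ring Quot I\<^esub> ?q 0"
        by (simp add: mult eq)
      moreover have "?q u \<in> quotient_component I d" "?q 0 \<in> quotient_component I d"
        using u by (auto simp: quotient_component_def homogeneous_component_def)
      ultimately have "?q u = ?q 0"
        using inj by (auto dest: inj_onD)
      then show "u \<in> I"
        by (simp add: eq)
    qed
  next
    assume inj: "mult_injective I L d"
    show "inj_on (\<lambda>u. ?q L \<otimes>\<^bsub>poly3_ring Quot I\<^esub> u) (quotient_component I d)"
    proof (rule inj_onI)
      fix U V assume "U \<in> quotient_component I d" "V \<in> quotient_component I d"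
        and LUV: "?q L \<otimes>\<^bsub>poly3_ring Quot I\<^esub> U = ?q L \<otimes>\<^bsub>poly3_ring Quot I\<^esub> V"
      then obtain u v where u: "u \<in> homogeneous_component d" "U = ?q u"
        and v: "v \<in> homogeneous_component d" "V = ?q v"
        by (auto simp: quotient_component_def)
      have "L * (u - v) \<in> I"
        using LUV by (simp add: u v mult eq right_diff_distrib)
      then have "u - v \<in> I"
        using inj u v homogeneous_component_closed(2) unfolding mult_injective_def by blast
      then show "U = V"
        by (simp add: u v eq)
    qed
  qed
  have surj: "(\<lambda>u. ?q L \<otimes>\<^bsub>poly3_ring Quot I\<^esub> u) ` quotient_component I d = quotient_component I (d + 1)
      \<longleftrightarrow> mult_surjective I L d" if L: "L \<in> homogeneous_component 1" for L d
  proof -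
    have image: "(\<lambda>u. ?q L \<otimes>\<^bsub>poly3_ring Quot I\<^esub> u) ` quotient_component I d
        = (\<lambda>u. ?q (L * u)) ` homogeneous_component d"
      by (simp add: quotient_component_def image_image mult)
    have "L * u \<in> homogeneous_component (d + 1)" if "u \<in> homogeneous_component d" for u
      using homogeneous_component_mult[OF L that] by (simp add: add.commute)
    then have "(\<lambda>u. ?q (L * u)) ` homogeneous_component d \<subseteq> quotient_component I (d + 1)"
      by (auto simp: quotient_component_def)
    then have "(\<lambda>u. ?q (L * u)) ` homogeneous_component d = quotient_component I (d + 1)
        \<longleftrightarrow> quotient_component I (d + 1) \<subseteq> (\<lambda>u. ?q (L * u)) ` homogeneous_component d"
      by blast
    then show ?thesis
      unfolding image mult_surjective_def eq[symmetric]
      by (simp add: quotient_component_def image_subset_iff image_iff)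
  qed
  show ?thesis
    unfolding weak_Lefschetz_property_def quotient_component_def[of I 1]
    using inj surj by (auto simp: bex_simps)
qed

section \<open>Multiplication by a linear form in monomial bases\<close>

definition linear_form :: "'k \<Rightarrow> 'k \<Rightarrow> 'k \<Rightarrow> 'k::field poly3" where
  "linear_form p q r = Poly_Mapping.single (1, 0, 0) p + Poly_Mapping.single (0, 1, 0) q
    + Poly_Mapping.single (0, 0, 1) r"

lemma homogeneous_component_one_iff:
  "L \<in> homogeneous_component 1 \<longleftrightarrow> (\<exists>p q r. L = linear_form p q r)"
proof
  assume "\<exists>p q r. L = linear_form p q r"
  then obtain p q r where L: "L = linear_form p q r"
    by blast
  show "L \<in> homogeneous_component 1"
    unfolding L linear_form_def
    by (intro homogeneous_component_closed(1)) (auto simp: homogeneous_component_def)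
next
  assume L: "L \<in> homogeneous_component 1"
  have keys: "Poly_Mapping.keys L \<subseteq> {(1, 0, 0), (0, 1, 0), (0, 0, 1)}"
  proof
    fix m assume m: "m \<in> Poly_Mapping.keys L"
    obtain i j k where ijk: "m = (i, j, k)"
      by (cases m) auto
    have "int (i + j + k) = 1"
      using L m unfolding homogeneous_component_def ijk by fastforce
    then have "i + j + k = 1"
      by linarith
    then show "m \<in> {(1, 0, 0), (0, 1, 0), (0, 0, 1)}"
      by (auto simp: ijk add_is_1)
  qed
  have "L = linear_form (Poly_Mapping.lookup L (1, 0, 0)) (Poly_Mapping.lookup L (0, 1, 0))
      (Poly_Mapping.lookup L (0, 0, 1))"
    by (subst sum_of_monomials[OF _ keys]) (auto simp: linear_form_def add.assoc)
  then show "\<exists>p q r. L = linear_form p q r"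
    by blast
qed

text \<open>The matrix of multiplication by \<open>p x + q y + r z\<close> in the monomial bases; the row is the target.\<close>

definition coeff_matrix ::
    "'k \<Rightarrow> 'k \<Rightarrow> 'k \<Rightarrow> nat \<times> nat \<times> nat \<Rightarrow> nat \<times> nat \<times> nat \<Rightarrow> 'k::field" where
  "coeff_matrix p q r n m = (if n = (1, 0, 0) + m then p else 0)
    + (if n = (0, 1, 0) + m then q else 0) + (if n = (0, 0, 1) + m then r else 0)"

lemma lookup_single_mult:
  fixes u :: "'k::field poly3"
  assumes "finite T" and "Poly_Mapping.keys u \<subseteq> T"
  shows "Poly_Mapping.lookup (Poly_Mapping.single e x * u) n =
    (\<Sum>m\<in>T. (if n = e + m then x else 0) * Poly_Mapping.lookup u m)"
proof -
  have "Poly_Mapping.single e x * u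
      = (\<Sum>m\<in>T. Poly_Mapping.single (e + m) (x * Poly_Mapping.lookup u m))"
    by (subst sum_of_monomials[OF assms]) (simp add: sum_distrib_left mult_single)
  then show ?thesis
    by (auto simp: lookup_sum lookup_single when_def intro!: sum.cong)
qed

lemma mem_homogeneous_component_nat:
  "u \<in> homogeneous_component (int d) \<longleftrightarrow>
    (\<forall>i j k. i + j + k \<noteq> d \<longrightarrow> Poly_Mapping.lookup u (i, j, k) = 0)"
proof -
  have "u \<in> homogeneous_component (int d) \<longleftrightarrow>
      (\<forall>i j k. (i, j, k) \<in> Poly_Mapping.keys u \<longrightarrow> i + j + k = d)"
    unfolding homogeneous_component_def of_nat_eq_iff by auto
  then show ?thesis
    unfolding in_keys_iff by metis
qed

text \<open>A monomial of \<open>u\<close> with exponent in \<open>E\<close> contributes only to exponents in \<open>E\<close>, so modulo the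
  ideal only the standard monomials of \<open>u\<close> matter.\<close>

lemma lookup_linear_form_mult:
  fixes u :: "'k::field poly3"
  assumes E: "upward_closed E" and u: "u \<in> homogeneous_component (int d)" and n: "n \<notin> E"
  shows "Poly_Mapping.lookup (linear_form p q r * u) n =
    (\<Sum>m\<in>standard_monomials E d. coeff_matrix p q r n m * Poly_Mapping.lookup u m)"
proof -
  let ?T = "Poly_Mapping.keys u \<union> standard_monomials E d"
  have zero: "coeff_matrix p q r n m * Poly_Mapping.lookup u m = 0"
    if "m \<notin> standard_monomials E d" for m
  proof (cases "m \<in> E")
    case True
    then have "n \<noteq> e + m" for e
      using E n unfolding upward_closed_def by blast
    then show ?thesis
      by (simp add: coeff_matrix_def)
  next
    case False
    then have "Poly_Mapping.lookup u m = 0"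
      using u that by (cases m) (auto simp: mem_homogeneous_component_nat)
    then show ?thesis
      by simp
  qed
  have "Poly_Mapping.lookup (linear_form p q r * u) n =
      (\<Sum>m\<in>?T. coeff_matrix p q r n m * Poly_Mapping.lookup u m)"
    by (simp add: linear_form_def distrib_right lookup_add lookup_single_mult[of ?T]
        coeff_matrix_def sum.distrib)
  also have "\<dots> = (\<Sum>m\<in>standard_monomials E d. coeff_matrix p q r n m * Poly_Mapping.lookup u m)"
    using zero by (intro sum.mono_neutral_right) auto
  finally show ?thesis .
qed

lemma linear_form_mult_homogeneous:
  assumes "u \<in> homogeneous_component d"
  shows "linear_form p q r * u \<in> homogeneous_component (d + 1)"
proof -
  have "linear_form p q r \<in> homogeneous_component 1"
    using homogeneous_component_one_iff by blast
  from homogeneous_component_mult[OF this assms] show ?thesis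
    by (simp add: add.commute)
qed

lemma mem_monomial_ideal_homogeneous:
  assumes "u \<in> homogeneous_component (int d)"
  shows "u \<in> monomial_ideal E \<longleftrightarrow> (\<forall>m\<in>standard_monomials E d. Poly_Mapping.lookup u m = 0)"
proof -
  have "(i, j, k) \<notin> E \<longrightarrow> Poly_Mapping.lookup u (i, j, k) = 0"
    if "\<forall>m\<in>standard_monomials E d. Poly_Mapping.lookup u m = 0" for i j k
    using assms that by (cases "i + j + k = d") (auto simp: mem_homogeneous_component_nat)
  then show ?thesis
    by (auto simp: mem_monomial_ideal_iff standard_monomials_def)
qed

lemma ex_standard_polynomial:
  fixes f :: "nat \<times> nat \<times> nat \<Rightarrow> 'k::field"
  shows "\<exists>u\<in>homogeneous_component (int d).
    \<forall>m\<in>standard_monomials E d. Poly_Mapping.lookup u m = f m"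
proof
  let ?u = "\<Sum>m\<in>standard_monomials E d. Poly_Mapping.single m (f m)"
  have lookup: "Poly_Mapping.lookup ?u n = (if n \<in> standard_monomials E d then f n else 0)" for n
    by (simp add: lookup_sum lookup_single when_def)
  show "?u \<in> homogeneous_component (int d)"
    by (simp add: mem_homogeneous_component_nat lookup)
  show "\<forall>m\<in>standard_monomials E d. Poly_Mapping.lookup ?u m = f m"
    by (simp add: lookup)
qed

lemma mult_injective_iff_system:
  fixes p q r :: "'k::field"
  assumes E: "upward_closed E"
  shows "mult_injective (monomial_ideal E) (linear_form p q r) (int d) \<longleftrightarrow>
    injective_system (coeff_matrix p q r) (standard_monomials E (Suc d)) (standard_monomials E d)"
proof -
  have prod: "linear_form p q r * u \<in> monomial_ideal E \<longleftrightarrow>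
      (\<forall>n\<in>standard_monomials E (Suc d).
        (\<Sum>m\<in>standard_monomials E d. coeff_matrix p q r n m * Poly_Mapping.lookup u m) = 0)"
    if u: "u \<in> homogeneous_component (int d)" for u :: "'k poly3"
  proof -
    have "linear_form p q r * u \<in> homogeneous_component (int (Suc d))"
      using linear_form_mult_homogeneous[OF u] by (simp add: add.commute)
    moreover have "n \<notin> E" if "n \<in> standard_monomials E (Suc d)" for n
      using that by (auto simp: standard_monomials_def)
    ultimately show ?thesis
      by (simp add: mem_monomial_ideal_homogeneous lookup_linear_form_mult[OF E u] del: of_nat_Suc)
  qed
  show ?thesis
  proof
    assume inj: "mult_injective (monomial_ideal E) (linear_form p q r) (int d)"
    show "injective_system (coeff_matrix p q r) (standard_monomials E (Suc d)) (standard_monomials E d)"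
      unfolding injective_system_def
    proof (intro allI impI)
      fix f assume f: "\<forall>n\<in>standard_monomials E (Suc d).
        (\<Sum>m\<in>standard_monomials E d. coeff_matrix p q r n m * f m) = 0"
      obtain u where u: "u \<in> homogeneous_component (int d)"
        "\<forall>m\<in>standard_monomials E d. Poly_Mapping.lookup u m = f m"
        using ex_standard_polynomial by blast
      then have "linear_form p q r * u \<in> monomial_ideal E"
        using f by (simp add: prod)
      then have "u \<in> monomial_ideal E"
        using inj u(1) unfolding mult_injective_def by blast
      then show "\<forall>m\<in>standard_monomials E d. f m = 0"
        using u by (simp add: mem_monomial_ideal_homogeneous)
    qed
  next
    assume inj: "injective_system (coeff_matrix p q r)
      (standard_monomials E (Suc d)) (standard_monomials E d)"
    show "mult_injective (monomial_ideal E) (linear_form p q r) (int d)"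
      unfolding mult_injective_def
    proof (intro ballI impI)
      fix u :: "'k poly3"
      assume u: "u \<in> homogeneous_component (int d)" and "linear_form p q r * u \<in> monomial_ideal E"
      then have "\<forall>m\<in>standard_monomials E d. Poly_Mapping.lookup u m = 0"
        using inj unfolding injective_system_def prod[OF u] by blast
      then show "u \<in> monomial_ideal E"
        using u by (simp add: mem_monomial_ideal_homogeneous)
    qed
  qed
qed

lemma mult_surjective_iff_system:
  fixes p q r :: "'k::field"
  assumes E: "upward_closed E"
  shows "mult_surjective (monomial_ideal E) (linear_form p q r) (int d) \<longleftrightarrow>
    surjective_system (coeff_matrix p q r) (standard_monomials E (Suc d)) (standard_monomials E d)"
proof -
  have prod: "v - linear_form p q r * u \<in> monomial_ideal E \<longleftrightarrow>
      (\<forall>n\<in>standard_monomials E (Suc d).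
        (\<Sum>m\<in>standard_monomials E d. coeff_matrix p q r n m * Poly_Mapping.lookup u m)
          = Poly_Mapping.lookup v n)"
    if u: "u \<in> homogeneous_component (int d)" and v: "v \<in> homogeneous_component (int (Suc d))"
    for u v :: "'k poly3"
  proof -
    have "linear_form p q r * u \<in> homogeneous_component (int (Suc d))"
      using linear_form_mult_homogeneous[OF u] by (simp add: add.commute)
    then have "v - linear_form p q r * u \<in> homogeneous_component (int (Suc d))"
      by (rule homogeneous_component_closed(2)[OF v])
    moreover have "n \<notin> E" if "n \<in> standard_monomials E (Suc d)" for n
      using that by (auto simp: standard_monomials_def)
    ultimately show ?thesis
      by (simp add: mem_monomial_ideal_homogeneous lookup_minus lookup_linear_form_mult[OF E u]
          eq_commute[of "Poly_Mapping.lookup v _"] del: of_nat_Suc)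
  qed
  show ?thesis
  proof
    assume surj: "mult_surjective (monomial_ideal E) (linear_form p q r) (int d)"
    show "surjective_system (coeff_matrix p q r) (standard_monomials E (Suc d)) (standard_monomials E d)"
      unfolding surjective_system_def
    proof
      fix g :: "nat \<times> nat \<times> nat \<Rightarrow> 'k"
      obtain v :: "'k poly3" where v: "v \<in> homogeneous_component (int (Suc d))"
        "\<forall>n\<in>standard_monomials E (Suc d). Poly_Mapping.lookup v n = g n"
        using ex_standard_polynomial by blast
      then obtain u where u: "u \<in> homogeneous_component (int d)"
        and "v - linear_form p q r * u \<in> monomial_ideal E"
        using surj unfolding mult_surjective_def by (metis add.commute of_nat_Suc)
      then have "\<forall>n\<in>standard_monomials E (Suc d).
          (\<Sum>m\<in>standard_monomials E d. coeff_matrix p q r n m * Poly_Mapping.lookup u m) = g n"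
        using v by (simp add: prod)
      then show "\<exists>f. \<forall>n\<in>standard_monomials E (Suc d).
          (\<Sum>m\<in>standard_monomials E d. coeff_matrix p q r n m * f m) = g n"
        by blast
    qed
  next
    assume surj: "surjective_system (coeff_matrix p q r)
      (standard_monomials E (Suc d)) (standard_monomials E d)"
    show "mult_surjective (monomial_ideal E) (linear_form p q r) (int d)"
      unfolding mult_surjective_def
    proof
      fix v :: "'k poly3" assume "v \<in> homogeneous_component (int d + 1)"
      then have v: "v \<in> homogeneous_component (int (Suc d))"
        by (simp add: add.commute)
      obtain f where f: "\<forall>n\<in>standard_monomials E (Suc d).
          (\<Sum>m\<in>standard_monomials E d. coeff_matrix p q r n m * f m) = Poly_Mapping.lookup v n"
        using surj unfolding surjective_system_def by metis
      obtain u where u: "u \<in> homogeneous_component (int d)"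
        "\<forall>m\<in>standard_monomials E d. Poly_Mapping.lookup u m = f m"
        using ex_standard_polynomial by blast
      then have "v - linear_form p q r * u \<in> monomial_ideal E"
        using f v by (simp add: prod)
      then show "\<exists>u\<in>homogeneous_component (int d). v - linear_form p q r * u \<in> monomial_ideal E"
        using u(1) by blast
    qed
  qed
qed

text \<open>A column relation at a standard monomial \<open>m\<close> is the annihilator relation at \<open>m\<close> for the
  extension of \<open>g\<close> by zero to \<open>E\<close>; at an exponent of \<open>E\<close> that relation is trivial, as all its
  terms are zero.\<close>

lemma transpose_injective_iff_no_annihilator:
  fixes p q r :: "'k::field"
  assumes E: "upward_closed E"
  shows "injective_system (\<lambda>m n. coeff_matrix p q r n m)
      (standard_monomials E d) (standard_monomials E (Suc d)) \<longleftrightarrow> no_annihilator E p q r d"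
proof -
  let ?std = "standard_monomials E (Suc d)"
  have column: "(\<Sum>n\<in>?std. coeff_matrix p q r n (i, j, k) * g n) =
      p * (if (Suc i, j, k) \<in> ?std then g (Suc i, j, k) else 0)
      + q * (if (i, Suc j, k) \<in> ?std then g (i, Suc j, k) else 0)
      + r * (if (i, j, Suc k) \<in> ?std then g (i, j, Suc k) else 0)" for i j k g
  proof -
    have "coeff_matrix p q r n (i, j, k) * g n = p * (if n = (Suc i, j, k) then g n else 0)
        + q * (if n = (i, Suc j, k) then g n else 0) + r * (if n = (i, j, Suc k) then g n else 0)" for n
      by (simp add: coeff_matrix_def)
    then show ?thesis
      by (simp add: sum.distrib flip: sum_distrib_left)
  qed
  have raise: "(Suc i, j, k) \<in> E" "(i, Suc j, k) \<in> E" "(i, j, Suc k) \<in> E"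
    if "(i, j, k) \<in> E" for i j k
  proof -
    have "n + (i, j, k) \<in> E" for n
      using E that unfolding upward_closed_def by blast
    from this[of "(1, 0, 0)"] this[of "(0, 1, 0)"] this[of "(0, 0, 1)"]
    show "(Suc i, j, k) \<in> E" "(i, Suc j, k) \<in> E" "(i, j, Suc k) \<in> E"
      by simp_all
  qed
  show ?thesis
  proof
    assume inj: "injective_system (\<lambda>m n. coeff_matrix p q r n m) (standard_monomials E d) ?std"
    show "no_annihilator E p q r d"
      unfolding no_annihilator_def
    proof (intro allI impI)
      fix f :: "nat \<Rightarrow> nat \<Rightarrow> nat \<Rightarrow> 'k" and i j k
      assume f: "annihilates E p q r d f" and deg: "i + j + k = Suc d"
      define g where "g = (\<lambda>(i, j, k). f i j k)"
      have std: "(if (i, j, k) \<in> ?std then g (i, j, k) else 0) = f i j k" if "i + j + k = Suc d" for i j k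
        using f that by (auto simp: annihilates_def g_def)
      have "\<forall>m\<in>standard_monomials E d. (\<Sum>n\<in>?std. coeff_matrix p q r n m * g n) = 0"
      proof
        fix m assume m: "m \<in> standard_monomials E d"
        obtain i j k where ijk: "m = (i, j, k)"
          by (cases m) auto
        have deg: "i + j + k = d"
          using m by (simp add: ijk)
        then have "p * f (Suc i) j k + q * f i (Suc j) k + r * f i j (Suc k) = 0"
          using f by (simp add: annihilates_def)
        then show "(\<Sum>n\<in>?std. coeff_matrix p q r n m * g n) = 0"
          using std[of "Suc i" j k] std[of i "Suc j" k] std[of i j "Suc k"] deg
          unfolding ijk column by (simp only: add_Suc add_Suc_right simp_thms)
      qed
      then have "\<forall>n\<in>?std. g n = 0"
        using inj unfolding injective_system_def by blast
      then show "f i j k = 0"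
        using std[OF deg] by (auto split: if_splits)
    qed
  next
    assume triv: "no_annihilator E p q r d"
    show "injective_system (\<lambda>m n. coeff_matrix p q r n m) (standard_monomials E d) ?std"
      unfolding injective_system_def
    proof (intro allI impI ballI)
      fix g n
      assume g: "\<forall>m\<in>standard_monomials E d. (\<Sum>n\<in>?std. coeff_matrix p q r n m * g n) = 0"
        and n: "n \<in> ?std"
      define f where "f = (\<lambda>i j k. if (i, j, k) \<in> ?std then g (i, j, k) else 0)"
      have "annihilates E p q r d f"
        unfolding annihilates_def
      proof (intro conjI allI impI)
        fix i j k assume "i + j + k = d"
        show "p * f (Suc i) j k + q * f i (Suc j) k + r * f i j (Suc k) = 0"
        proof (cases "(i, j, k) \<in> E")
          case True
          then show ?thesis
            using raise[OF True] by (simp add: f_def)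
        next
          case False
          then have "(i, j, k) \<in> standard_monomials E d"
            using \<open>i + j + k = d\<close> by simp
          then show ?thesis
            using g unfolding f_def column[symmetric] by blast
        qed
      qed (simp add: f_def)
      moreover obtain i j k where ijk: "n = (i, j, k)"
        by (cases n) auto
      ultimately have "f i j k = 0"
        using n by (intro no_annihilatorD[OF triv]) auto
      then show "g n = 0"
        using n by (simp add: f_def ijk)
    qed
  qed
qed

text \<open>A monomial of degree \<open>d + 2\<close> is a variable times one of degree \<open>d + 1\<close>; multiply a preimage of
  the latter by that variable.\<close>

lemma mult_surjective_Suc:
  fixes p q r :: "'k::field"
  assumes E: "upward_closed E"
    and surj: "mult_surjective (monomial_ideal E) (linear_form p q r) (int d)"
  shows "mult_surjective (monomial_ideal E) (linear_form p q r) (int (Suc d))"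
proof -
  let ?I = "monomial_ideal E :: 'k poly3 set" and ?L = "linear_form p q r"
  let ?J = "{v. \<exists>u\<in>homogeneous_component (int (Suc d)). v - ?L * u \<in> ?I}"
  have monomial: "Poly_Mapping.single m x \<in> ?J"
    if deg: "case m of (i, j, k) \<Rightarrow> i + j + k = Suc (Suc d)" for m x
  proof -
    obtain i j k where ijk: "m = (i, j, k)"
      by (cases m) auto
    then consider "0 < i" | "0 < j" | "0 < k"
      using deg by fastforce
    then obtain e i' j' k' where m: "m = e + (i', j', k')" and e: "e \<in> {(1, 0, 0), (0, 1, 0), (0, 0, 1)}"
      and deg': "i' + j' + k' = Suc d"
    proof cases
      case 1
      then show thesis using deg ijk by (intro that[of "(1, 0, 0)" "i - 1" j k]) auto
    next
      case 2
      then show thesis using deg ijk by (intro that[of "(0, 1, 0)" i "j - 1" k]) auto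
    next
      case 3
      then show thesis using deg ijk by (intro that[of "(0, 0, 1)" i j "k - 1"]) auto
    qed
    have "Poly_Mapping.single (i', j', k') x \<in> homogeneous_component (int d + 1)"
      using deg' by (auto simp: homogeneous_component_def)
    then obtain u where u: "u \<in> homogeneous_component (int d)"
      and I: "Poly_Mapping.single (i', j', k') x - ?L * u \<in> ?I"
      using surj unfolding mult_surjective_def by blast
    have "Poly_Mapping.single e 1 * (Poly_Mapping.single (i', j', k') x - ?L * u) \<in> ?I"
      by (rule monomial_ideal_mult[OF E I])
    moreover have "Poly_Mapping.single e 1 * (Poly_Mapping.single (i', j', k') x - ?L * u)
        = Poly_Mapping.single m x - ?L * (Poly_Mapping.single e 1 * u)"
      by (simp add: m right_diff_distrib mult_single mult.left_commute)
    moreover have "Poly_Mapping.single e 1 * u \<in> homogeneous_component (1 + int d)"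
      using e by (intro homogeneous_component_mult u) (auto simp: homogeneous_component_def)
    ultimately show ?thesis
      by auto
  qed
  have zero: "0 \<in> ?J"
    by (rule CollectI, rule bexI[of _ 0]) (simp_all add: homogeneous_component_def monomial_ideal_def)
  have add: "v + w \<in> ?J" if vw: "v \<in> ?J" "w \<in> ?J" for v w
  proof -
    obtain u1 u2 where u: "u1 \<in> homogeneous_component (int (Suc d))" "v - ?L * u1 \<in> ?I"
      "u2 \<in> homogeneous_component (int (Suc d))" "w - ?L * u2 \<in> ?I"
      using vw by blast
    have sum: "v + w - ?L * (u1 + u2) = (v - ?L * u1) + (w - ?L * u2)"
      by (simp add: algebra_simps)
    have "v + w - ?L * (u1 + u2) \<in> ?I"
      using u(2,4) unfolding sum mem_monomial_ideal_iff lookup_add by simp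
    then show ?thesis
      using homogeneous_component_closed(1)[OF u(1,3)] by blast
  qed
  show ?thesis
    unfolding mult_surjective_def
  proof
    fix v :: "'k poly3" assume v: "v \<in> homogeneous_component (int (Suc d) + 1)"
    have "(\<Sum>m\<in>Poly_Mapping.keys v. Poly_Mapping.single m (Poly_Mapping.lookup v m)) \<in> ?J"
    proof (intro sum_closed_set finite_keys zero add monomial)
      fix m assume "m \<in> Poly_Mapping.keys v"
      then show "case m of (i, j, k) \<Rightarrow> i + j + k = Suc (Suc d)"
        using v by (auto simp: homogeneous_component_def)
    qed
    then show "\<exists>u\<in>homogeneous_component (int (Suc d)). v - ?L * u \<in> ?I"
      using sum_of_monomials[of "Poly_Mapping.keys v" v] by simp
  qed
qed

text \<open>If \<open>L * u\<close> is in the ideal, so is \<open>L * (e * u)\<close> for each variable \<open>e\<close>, hence \<open>e * u\<close> is in the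
  ideal by injectivity in degree \<open>d + 1\<close>.  Thus \<open>u\<close> represents a socle element of degree \<open>d\<close>, and
  there is none but zero.\<close>

lemma mult_injective_pred:
  fixes p q r :: "'k::field"
  assumes E: "upward_closed E"
    and inj: "mult_injective (monomial_ideal E) (linear_form p q r) (int (Suc d))"
    and no_socle: "\<And>i j k. (i, j, k) \<notin> E \<Longrightarrow> i + j + k = d \<Longrightarrow>
      (Suc i, j, k) \<notin> E \<or> (i, Suc j, k) \<notin> E \<or> (i, j, Suc k) \<notin> E"
  shows "mult_injective (monomial_ideal E) (linear_form p q r) (int d)"
  unfolding mult_injective_def
proof (intro ballI impI)
  fix u :: "'k poly3"
  assume u: "u \<in> homogeneous_component (int d)" and Lu: "linear_form p q r * u \<in> monomial_ideal E"
  have vanish: "Poly_Mapping.lookup u m = 0"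
    if e: "e \<in> {(1, 0, 0), (0, 1, 0), (0, 0, 1)}" and "e + m \<notin> E" for e m
  proof -
    have "Poly_Mapping.single e 1 * (linear_form p q r * u) \<in> monomial_ideal E"
      by (rule monomial_ideal_mult[OF E Lu])
    then have "linear_form p q r * (Poly_Mapping.single e 1 * u) \<in> monomial_ideal E"
      by (simp add: mult.left_commute)
    moreover have "Poly_Mapping.single e 1 * u \<in> homogeneous_component (1 + int d)"
      using e by (intro homogeneous_component_mult u) (auto simp: homogeneous_component_def)
    ultimately have "Poly_Mapping.single e 1 * u \<in> monomial_ideal E"
      using inj unfolding mult_injective_def by simp
    then have "0 = Poly_Mapping.lookup (Poly_Mapping.single e 1 * u) (e + m)"
      using that(2) unfolding mem_monomial_ideal_iff by metis
    also have "\<dots> = (\<Sum>m'\<in>insert m (Poly_Mapping.keys u).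
        if m' = m then Poly_Mapping.lookup u m else 0)"
    proof -
      have "Poly_Mapping.keys u \<subseteq> insert m (Poly_Mapping.keys u)"
        by blast
      from lookup_single_mult[OF _ this] show ?thesis
        by (auto simp del: sum.insert sum.delta sum.delta' intro!: sum.cong)
    qed
    also have "\<dots> = Poly_Mapping.lookup u m"
      by (subst sum.delta) auto
    finally show ?thesis ..
  qed
  have "Poly_Mapping.lookup u (i, j, k) = 0" if "(i, j, k) \<notin> E" for i j k
  proof (cases "i + j + k = d")
    case True
    then show ?thesis
      using no_socle[OF that] vanish[of "(1, 0, 0)" "(i, j, k)"] vanish[of "(0, 1, 0)" "(i, j, k)"]
        vanish[of "(0, 0, 1)" "(i, j, k)"] by auto
  next
    case False
    then show ?thesis
      using u by (auto simp: mem_homogeneous_component_nat)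
  qed
  then show "u \<in> monomial_ideal E"
    by (auto simp: mem_monomial_ideal_iff)
qed

context balanced_mixed_ideal
begin

text \<open>The dimensions in degrees \<open>S\<close> and \<open>S + 1\<close> agree, so already degree \<open>S\<close> of the property gives
  the left-to-right direction.  Conversely \<open>x + y + z\<close> is bijective in degree \<open>S\<close>, which spreads to
  surjectivity above and injectivity below.\<close>

lemma weak_Lefschetz_property_iff_no_annihilator:
  "weak_Lefschetz_property (poly3_ring Quot (monomial_ideal E :: 'k::field poly3 set))
      (quotient_component (monomial_ideal E)) \<longleftrightarrow> no_annihilator E (1::'k) 1 1 S"
proof -
  let ?I = "monomial_ideal E :: 'k poly3 set"
  have up: "upward_closed E"
    by (rule upward_closed_mixed_ideal_exponents)
  have card: "card (standard_monomials E S) = card (standard_monomials E (Suc S))"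
    by (rule card_standard_monomials_eq[symmetric])
  note square = square_system[OF finite_standard_monomials finite_standard_monomials card]
  have WLP: "weak_Lefschetz_property (poly3_ring Quot ?I) (quotient_component ?I) \<longleftrightarrow>
      (\<exists>p q r. \<forall>d. mult_injective ?I (linear_form p q r) d \<or> mult_surjective ?I (linear_form p q r) d)"
    unfolding quotient_weak_Lefschetz_property[OF ideal_monomial_ideal[OF up]]
    using homogeneous_component_one_iff by metis
  show ?thesis
    unfolding WLP
  proof
    assume "\<exists>p q r. \<forall>d. mult_injective ?I (linear_form p q r) d \<or> mult_surjective ?I (linear_form p q r) d"
    then obtain p q r where
      "mult_injective ?I (linear_form p q r) (int S) \<or> mult_surjective ?I (linear_form p q r) (int S)"
      by blast
    then have "no_annihilator E p q r S"
      unfolding mult_injective_iff_system[OF up] mult_surjective_iff_system[OF up]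
        transpose_injective_iff_no_annihilator[OF up, symmetric]
      using square(1) surjective_imp_transpose_injective[OF finite_standard_monomials finite_standard_monomials]
      by blast
    then show "no_annihilator E (1::'k) 1 1 S"
      by (rule no_annihilator_sum_of_variables)
  next
    assume triv: "no_annihilator E (1::'k) 1 1 S"
    let ?L = "linear_form 1 1 1 :: 'k poly3"
    have inj: "injective_system (coeff_matrix (1::'k) 1 1)
        (standard_monomials E (Suc S)) (standard_monomials E S)"
      unfolding square(1) transpose_injective_iff_no_annihilator[OF up] by (rule triv)
    have "mult_injective ?I ?L d \<or> mult_surjective ?I ?L d" for d
    proof -
      \<comment> \<open>In negative degrees the only homogeneous polynomial is zero.\<close>
      consider n where "d = int n" "S \<le> n" | n where "d = int n" "n \<le> S" | "d < 0"
        by (metis int_nat_eq linorder_le_cases not_le)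
      then show ?thesis
      proof cases
        case 1
        have "mult_surjective ?I ?L (int n)"
          using \<open>S \<le> n\<close>
        proof (induction n rule: dec_induct)
          case base
          show ?case
            using square(2)[OF inj] by (simp add: mult_surjective_iff_system[OF up])
        next
          case (step n)
          then show ?case
            by (intro mult_surjective_Suc[OF up])
        qed
        then show ?thesis
          using 1 by simp
      next
        case 2
        have "mult_injective ?I ?L (int n)"
          using \<open>n \<le> S\<close>
        proof (induction n rule: inc_induct)
          case base
          show ?case
            using inj by (simp add: mult_injective_iff_system[OF up])
        next
          case (step n)
          show ?case
            by (rule mult_injective_pred[OF up step.IH])
              (use standard_monomial_below_socle step.hyps in auto)
        qed
        then show ?thesis
          using 2 by simp
      next
        case 3
        have "u \<in> ?I" if "u \<in> homogeneous_component d" for u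
        proof -
          have "m \<notin> Poly_Mapping.keys u" for m
            using that 3 unfolding homogeneous_component_def by (cases m) fastforce
          then show ?thesis
            by (auto simp: monomial_ideal_def)
        qed
        then show ?thesis
          by (simp add: mult_injective_def)
      qed
    qed
    then show "\<exists>p q r. \<forall>d. mult_injective ?I (linear_form p q r) d \<or> mult_surjective ?I (linear_form p q r) d"
      by blast
  qed
qed

end

theorem proposition3p9:
  fixes a b c \<alpha> \<beta> \<gamma> :: nat
    and s A B C M :: int
    and R :: "'k::field poly3 ring"
    and I :: "'k poly3 set"
  assumes "infinite (UNIV :: 'k set)"
    and "\<alpha> < a" and "\<beta> < b" and "\<gamma> < c"
    and "\<not> (\<alpha> = 0 \<and> \<beta> = 0)" and "\<not> (\<alpha> = 0 \<and> \<gamma> = 0)" and "\<not> (\<beta> = 0 \<and> \<gamma> = 0)"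
    and "R = ring_of_type_algebra"
    and "I = Idl\<^bsub>R\<^esub> {var_x ^ a, var_y ^ b, var_z ^ c, var_x ^ \<alpha> * var_y ^ \<beta> * var_z ^ \<gamma>}"
    and "[a + b + c + \<alpha> + \<beta> + \<gamma> = 0] (mod 3)"
    and "s = int (a + b + c + \<alpha> + \<beta> + \<gamma>) div 3 - 2"
    and "A = s + 2 - int a" and "B = s + 2 - int b" and "C = s + 2 - int c"
    and "M = s + 2 - int (\<alpha> + \<beta> + \<gamma>)"
    and "0 \<le> M"
    and "0 \<le> A" and "A \<le> int (\<beta> + \<gamma>)"
    and "0 \<le> B" and "B \<le> int (\<alpha> + \<gamma>)"
    and "0 \<le> C" and "C \<le> int (\<alpha> + \<beta>)"
  shows "\<exists>N :: int mat.
    N \<in> carrier_mat (nat (C + M)) (nat (C + M)) \<and>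
    (weak_Lefschetz_property (R Quot I) (quotient_component I) \<longleftrightarrow>
      \<not> [det N = 0] (mod int CHAR('k))) \<and>
    (\<forall>i \<in> {1..nat (C + M)}. \<forall>j \<in> {1..nat (C + M)}.
      N $$ (i - 1, j - 1) =
        (if int i \<le> C then int_binomial c (A + int j - int i)
         else int_binomial \<gamma> (A + C - int \<beta> + int j - int i)))"
proof -
  have "3 dvd a + b + c + \<alpha> + \<beta> + \<gamma>"
    using assms(10) by (simp add: cong_0_iff)
  then obtain t where t: "a + b + c + \<alpha> + \<beta> + \<gamma> = 3 * t"
    by (elim dvdE)
  have "1 \<le> a" "1 \<le> b" "1 \<le> c" "1 \<le> \<alpha> + \<beta>"
    using assms(2-5) by auto
  then have "2 \<le> t"
    using t by linarith
  then obtain S where S: "t = S + 2"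
    by (metis add.commute le_Suc_ex)
  have s: "s = int S"
    unfolding assms(11) t S by simp
  obtain A' where A': "A = int A'"
    using assms(17) by (metis nonneg_int_cases)
  obtain B' where B': "B = int B'"
    using assms(19) by (metis nonneg_int_cases)
  obtain C' where C': "C = int C'"
    using assms(21) by (metis nonneg_int_cases)
  obtain M' where M': "M = int M'"
    using assms(16) by (metis nonneg_int_cases)
  have total: "a + b + c + \<alpha> + \<beta> + \<gamma> = 3 * S + 6"
    using t S by simp
  interpret balanced_mixed_ideal a b c \<alpha> \<beta> \<gamma> S A' B' C' M'
    using assms(2-4,12-15,18,20,22) total unfolding s A' B' C' M' by unfold_locales linarith+
  have size: "nat (C + M) = C' + M'"
    unfolding C' M' by simp
  have I: "I = monomial_ideal E"
    unfolding assms(8,9) by (rule genideal_eq_monomial_ideal)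
  have "weak_Lefschetz_property (R Quot I) (quotient_component I) \<longleftrightarrow> of_int (det N) \<noteq> (0::'k)"
    unfolding det_nonzero_iff_no_annihilator I assms(8)
    by (rule weak_Lefschetz_property_iff_no_annihilator)
  also have "\<dots> \<longleftrightarrow> \<not> [det N = 0] (mod int CHAR('k))"
    using of_int_eq_iff_cong_CHAR[of "det N" 0, where 'a = 'k] by simp
  finally have WLP: "weak_Lefschetz_property (R Quot I) (quotient_component I) \<longleftrightarrow>
      \<not> [det N = 0] (mod int CHAR('k))" .
  have entries: "N $$ (i - 1, j - 1) = (if int i \<le> C then int_binomial c (A + int j - int i)
      else int_binomial \<gamma> (A + C - int \<beta> + int j - int i))"
    if i: "i \<in> {1..C' + M'}" and j: "j \<in> {1..C' + M'}" for i j
  proof -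
    obtain i' j' where "i = Suc i'" "j = Suc j'"
      using i j by (metis One_nat_def Suc_le_D atLeastAtMost_iff)
    then show ?thesis
      using i j by (simp add: N_def A' C' algebra_simps)
  qed
  show ?thesis
    unfolding size using WLP entries by (intro exI[of _ N]) (simp add: N_def)
qed

end
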